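(* Let $m_0,m_1\in\mathbb R^n$, let $\Sigma_0,\Sigma_1$ be symmetric positive definite $n\times n$ matrices, let $\rho_0=\mathcal N(m_0,\Sigma_0)$ and $\rho_1=\mathcal N(m_1,\Sigma_1)$, and let $\lambda:[0,1)\to[0,\infty)$ be continuous. Let $\rho_t=\mathcal N(m(t),\Sigma(t))$, $t\in[0,1)$, be the Gaussian averaged sliced flow (see context). Suppose that $$\int_0^1\lambda(t)\,\mathrm dt=\infty$$ and that $\Sigma(t)\succeq\alpha I$ on $[0,1)$ for some $\alpha>0$. Put $r(t):=SW_2(\rho_t,\rho_1)$ and $$\beta:=n\Bigl(\sqrt{\tfrac{\mathrm{tr}(\Sigma_1)}{n}}+r(0)\Bigr)^2,\qquad \chi_*:=\min\Bigl\{1,\frac{2\alpha\sqrt{\lambda_{\min}(\Sigma_1)}}{\beta^{3/2}(n+2)}\Bigr\}.$$ Then for every $t\in[0,1)$ $$r(t)\le r(0)\exp\Bigl(-\frac{\chi_*}{n}\int_0^t\lambda(s)\,\mathrm ds\Bigr).$$ Consequently, $m(t)\to m_1$ and $\Sigma(t)\to\Sigma_1$ as $t\nearrow1$.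
   Context: $\mathcal S^{n-1}$ is the unit sphere of $\mathbb R^n$ and $\sigma$ its uniform probability measure. For $\theta\in\mathcal S^{n-1}$, $\mu_\theta$ is the pushforward of $\mu$ under $x\mapsto\theta^\top x$; $SW_2^2(\mu,\nu)=\int_{\mathcal S^{n-1}}W_2^2(\mu_\theta,\nu_\theta)\,\sigma(\mathrm d\theta)$, with $W_2$ the Wasserstein-2 distance. $\lambda_{\min}$ denotes the smallest eigenvalue. For $\Sigma\succ0$ set $$H(\Sigma):=\int_{\mathcal S^{n-1}}\sqrt{\frac{\theta^\top\Sigma_1\theta}{\theta^\top\Sigma\theta}}\;\theta\theta^\top\,\sigma(\mathrm d\theta)-\frac1nI .$$ The Gaussian averaged sliced flow is $\rho_t=\mathcal N(m(t),\Sigma(t))$, where $\Sigma$ is the unique positive definite solution on $[0,1)$ of $\dot\Sigma=\lambda(t)\bigl(H(\Sigma)\Sigma+\Sigma H(\Sigma)\bigr)$, $\Sigma(0)=\Sigma_0$, and $m(t)=m_1+\exp\bigl(-\frac1n\int_0^t\lambda(s)\,\mathrm ds\bigr)(m_0-m_1)$. (The target law is denoted $\rho_1$; the curve $\rho_t$ is only defined for $t<1$.) *)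

theory Defs
  imports "HOL-Probability.Probability"
begin

subsection \<open>Matrices\<close>

definition sym_posdef :: "real^'n^'n \<Rightarrow> bool" where
  "sym_posdef A \<longleftrightarrow> transpose A = A \<and> (\<forall>x. x \<noteq> 0 \<longrightarrow> 0 < x \<bullet> (A *v x))"

definition sym_possemidef :: "real^'n^'n \<Rightarrow> bool" where
  "sym_possemidef A \<longleftrightarrow> transpose A = A \<and> (\<forall>x. 0 \<le> x \<bullet> (A *v x))"

definition loewner_le :: "real^'n^'n \<Rightarrow> real^'n^'n \<Rightarrow> bool" where
  "loewner_le A B \<longleftrightarrow> sym_possemidef (B - A)"

definition eigval :: "real^'n^'n \<Rightarrow> real \<Rightarrow> bool" where
  "eigval A c \<longleftrightarrow> (\<exists>v. v \<noteq> 0 \<and> A *v v = c *\<^sub>R v)"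

text \<open>Only meaningful when a smallest real eigenvalue exists, in particular for symmetric \<open>A\<close>.\<close>

definition lambda_min :: "real^'n^'n \<Rightarrow> real" where
  "lambda_min A = (LEAST c. eigval A c)"

definition outer :: "real^'n \<Rightarrow> real^'n^'n" where
  "outer v = (\<chi> i j. v $ i * v $ j)"


subsection \<open>Gaussian laws\<close>

text \<open>The Lebesgue density of the normal law; used only for positive definite covariance.\<close>

definition gaussian :: "real^'n \<Rightarrow> real^'n^'n \<Rightarrow> (real^'n) measure" where
  "gaussian m A = density lborel (\<lambda>x. ennreal
     (exp (- ((x - m) \<bullet> (matrix_inv A *v (x - m))) / 2) / sqrt ((2 * pi) ^ CARD('n) * det A)))"


subsection \<open>Sliced Wasserstein distance\<close>

text \<open>
  The uniform probability measure on the unit sphere, realised as the radial projection of the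
  uniform measure on the unit ball. It is a Borel measure on the whole space that is concentrated
  on \<open>sphere 0 1\<close> (the origin, where the projection takes the value 0, is a null set), so
  integrals over the sphere are written as integrals with respect to this measure. In dimension 1
  it gives mass 1/2 to each of the two unit vectors.
\<close>

definition sphere_unif :: "(real^'n) measure" where
  "sphere_unif = distr (uniform_measure lborel (ball 0 1)) borel (\<lambda>x. x /\<^sub>R norm x)"

definition slice :: "(real^'n) measure \<Rightarrow> real^'n \<Rightarrow> real measure" where
  "slice \<mu> \<theta> = distr \<mu> borel (\<lambda>x. \<theta> \<bullet> x)"

definition couplings :: "'a measure \<Rightarrow> 'a measure \<Rightarrow> ('a \<times> 'a) measure set" where
  "couplings \<mu> \<nu> =
     {\<pi>. sets \<pi> = sets (\<mu> \<Otimes>\<^sub>M \<nu>) \<and> distr \<pi> \<mu> fst = \<mu> \<and> distr \<pi> \<nu> snd = \<nu>}"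

definition W2_squared :: "'a::metric_space measure \<Rightarrow> 'a measure \<Rightarrow> ennreal" where
  "W2_squared \<mu> \<nu> = (INF \<pi>\<in>couplings \<mu> \<nu>. \<integral>\<^sup>+ z. ennreal ((dist (fst z) (snd z))\<^sup>2) \<partial>\<pi>)"

definition SW2_squared :: "(real^'n) measure \<Rightarrow> (real^'n) measure \<Rightarrow> ennreal" where
  "SW2_squared \<mu> \<nu> = (\<integral>\<^sup>+ \<theta>. W2_squared (slice \<mu> \<theta>) (slice \<nu> \<theta>) \<partial>sphere_unif)"

text \<open>
  The conversion to a real number is harmless for laws with finite second moments, such as
  Gaussian laws, because \<open>SW2_squared\<close> is then finite.
\<close>

definition SW2 :: "(real^'n) measure \<Rightarrow> (real^'n) measure \<Rightarrow> real" where
  "SW2 \<mu> \<nu> = sqrt (enn2real (SW2_squared \<mu> \<nu>))"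


subsection \<open>The Gaussian averaged sliced flow\<close>

definition H_mat :: "real^'n^'n \<Rightarrow> real^'n^'n \<Rightarrow> real^'n^'n" where
  "H_mat \<Sigma>\<^sub>1 \<Sigma> =
     (\<integral>\<theta>. sqrt ((\<theta> \<bullet> (\<Sigma>\<^sub>1 *v \<theta>)) / (\<theta> \<bullet> (\<Sigma> *v \<theta>))) *\<^sub>R outer \<theta> \<partial>sphere_unif)
       - (1 / real CARD('n)) *\<^sub>R mat 1"

text \<open>
  The mean \<open>m\<close> and covariance \<open>\<Sigma>\<close> of the flow; only their values on \<open>{0..<1}\<close> matter,
  and the derivative at 0 is one-sided.
\<close>

definition gaussian_sliced_flow ::
  "(real \<Rightarrow> real) \<Rightarrow> real^'n \<Rightarrow> real^'n^'n \<Rightarrow> real^'n \<Rightarrow> real^'n^'n \<Rightarrow>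
   (real \<Rightarrow> real^'n) \<Rightarrow> (real \<Rightarrow> real^'n^'n) \<Rightarrow> bool" where
  "gaussian_sliced_flow lam m\<^sub>0 \<Sigma>\<^sub>0 m\<^sub>1 \<Sigma>\<^sub>1 m \<Sigma> \<longleftrightarrow>
     \<Sigma> 0 = \<Sigma>\<^sub>0 \<and>
     (\<forall>t\<in>{0..<1}. sym_posdef (\<Sigma> t)) \<and>
     (\<forall>t\<in>{0..<1}. (\<Sigma> has_vector_derivative
        lam t *\<^sub>R (H_mat \<Sigma>\<^sub>1 (\<Sigma> t) ** \<Sigma> t + \<Sigma> t ** H_mat \<Sigma>\<^sub>1 (\<Sigma> t))) (at t within {0..<1})) \<and>
     (\<forall>t\<in>{0..<1}. m t =
        m\<^sub>1 + exp (- (1 / real CARD('n)) * integral {0..t} lam) *\<^sub>R (m\<^sub>0 - m\<^sub>1))"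

end

theory Submission
  imports Defs
begin

text \<open>
  Slices of Gaussian laws are one-dimensional Gaussian laws, so the squared sliced distance of \<open>\<rho> t\<close>
  and \<open>\<rho>\<^sub>1\<close> is \<open>(norm (m t - m\<^sub>1))\<^sup>2 / n + F (\<Sigma> t)\<close>, where \<open>F \<Sigma>\<close> is the integral over the sphere of
  \<open>(sqrt a - sqrt b)\<^sup>2\<close> with \<open>a = \<theta> \<bullet> (\<Sigma> *v \<theta>)\<close> and \<open>b = \<theta> \<bullet> (\<Sigma>\<^sub>1 *v \<theta>)\<close>. The first summand decays
  explicitly. The function \<open>F\<close> is convex with gradient \<open>- H\<close>, so along the flow it decreases with speed
  \<open>2 * lam t * (H \<bullet> (H ** \<Sigma>)) \<ge> 2 * \<alpha> * lam t * (norm H)\<^sup>2\<close>. In particular \<open>r\<close> is nonincreasing, whence the trace of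
  \<open>\<Sigma> t\<close> stays below \<open>\<beta>\<close>; under this bound \<open>(norm H)\<^sup>2\<close> dominates a multiple of \<open>F\<close>, and
  Gronwall's inequality gives the exponential rate.
\<close>

subsection \<open>Symmetric matrices\<close>

text \<open>The domination of \<open>F\<close> by \<open>(norm H)\<^sup>2\<close> is a
  Polyak-Lojasiewicz inequality, and it is the source of the constants. A lower bound for the
  pairing \<open>H \<bullet> (\<Sigma>\<^sub>1 - \<Sigma>)\<close> in terms of \<open>F\<close> is
  easy, but passing from the pairing to \<open>norm H\<close> by Cauchy-Schwarz introduces
  \<open>norm (\<Sigma>\<^sub>1 - \<Sigma>)\<close>, which must in turn be controlled by the same
  pairing. Fourth moments of the sphere achieve this at the price of \<open>n * (n + 2)\<close>. The
  power 3/2 of \<open>\<beta>\<close> splits into a full factor, from estimating the squared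
  difference of the quadratic forms by the pairing, and a square root, from the lower bound
  \<open>sqrt (lambda_min \<Sigma>\<^sub>1 / \<beta>)\<close> for the ratio of their roots. The
  factor \<open>\<alpha>\<close> is the coercivity of \<Sigma> in
  \<open>H \<bullet> (H ** \<Sigma>)\<close>. The cap 1 in the rate comes from the mean, whose
  contribution to the squared distance decays with exponent \<open>2 / n\<close>.\<close>

lemma symmetric_matrix_inner:
  fixes A :: "real^'n^'n"
  assumes "transpose A = A"
  shows "(A *v x) \<bullet> y = x \<bullet> (A *v y)"
  by (metis assms dot_lmul_matrix transpose_matrix_vector)

lemma inner_outer: "outer v \<bullet> D = v \<bullet> (D *v v)"
  by (simp add: inner_vec_def outer_def matrix_vector_mult_def sum_distrib_left mult_ac)

lemma norm_outer: "norm (outer v) = (norm v)\<^sup>2"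
proof -
  have "outer v *v v = (v \<bullet> v) *\<^sub>R v"
    by (simp add: vec_eq_iff outer_def matrix_vector_mult_def inner_vec_def sum_distrib_left mult_ac)
  then have "outer v \<bullet> outer v = (v \<bullet> v)\<^sup>2"
    by (simp add: inner_outer power2_eq_square)
  then show ?thesis
    by (simp add: norm_eq_sqrt_inner real_sqrt_power power2_eq_square)
qed

text \<open>The Rayleigh quotient attains its minimum on the unit sphere of \<open>W\<close>. The
  residual \<open>u\<close> of a minimizer \<open>v\<close> must vanish, since moving from
  \<open>v\<close> against \<open>u\<close> would lower the quotient; invariance of \<open>W\<close>
  keeps that direction admissible. The form relative to a subspace lets eigenvectors be split off
  one at a time, and \<open>W = UNIV\<close> yields the smallest eigenvalue.\<close>

lemma symmetric_min_eigenvector: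
  fixes A :: "real^'n^'n"
  assumes sym: "transpose A = A" and W: "subspace W" and inv: "\<And>x. x \<in> W \<Longrightarrow> A *v x \<in> W"
    and w: "w \<in> W" "w \<noteq> 0"
  obtains v c where "v \<in> W" "norm v = 1" "A *v v = c *\<^sub>R v"
    "\<And>x. x \<in> W \<Longrightarrow> c * (x \<bullet> x) \<le> x \<bullet> (A *v x)"
proof -
  let ?S = "W \<inter> sphere 0 1"
  have "compact ?S"
    using closed_subspace[OF W] by (simp add: closed_Int_compact)
  moreover have "w /\<^sub>R norm w \<in> ?S"
    using w W by (simp add: subspace_scale)
  moreover have "continuous_on ?S (\<lambda>x. x \<bullet> (A *v x))"
    by (intro continuous_intros matrix_vector_mult_linear_continuous_on)
  ultimately obtain v where v: "v \<in> ?S" and vmin: "\<And>x. x \<in> ?S \<Longrightarrow> v \<bullet> (A *v v) \<le> x \<bullet> (A *v x)"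
    using continuous_attains_inf[of ?S "\<lambda>x. x \<bullet> (A *v x)"] by blast
  define c where "c = v \<bullet> (A *v v)"
  have vv: "v \<bullet> v = 1" using v by (simp add: norm_eq_1)
  have ge: "c * (x \<bullet> x) \<le> x \<bullet> (A *v x)" if x: "x \<in> W" for x
  proof (cases "x = 0")
    case False
    have "c \<le> (x /\<^sub>R norm x) \<bullet> (A *v (x /\<^sub>R norm x))"
      unfolding c_def by (rule vmin) (use x False W in \<open>simp add: subspace_scale\<close>)
    also have "\<dots> = (x \<bullet> (A *v x)) / (x \<bullet> x)"
      by (simp add: matrix_vector_mult_scaleR field_simps dot_square_norm power2_eq_square)
    finally show ?thesis
      using False by (simp add: field_simps)
  qed simp
  define u where "u = A *v v - c *\<^sub>R v"
  have uW: "u \<in> W"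
    using v W inv unfolding u_def by (simp add: subspace_diff subspace_scale)
  have Av: "A *v v = u + c *\<^sub>R v" by (simp add: u_def)
  have uv: "u \<bullet> v = 0" "v \<bullet> u = 0"
    using vv by (auto simp: u_def c_def inner_simps inner_commute)
  define q where "q = u \<bullet> (A *v u) - c * (u \<bullet> u)"
  have q: "0 \<le> 2 * t * (u \<bullet> u) + t\<^sup>2 * q" for t :: real
  proof -
    have "v \<bullet> (A *v u) = (u + c *\<^sub>R v) \<bullet> u"
      using symmetric_matrix_inner[OF sym, of v u] Av by simp
    moreover have "c * ((v + t *\<^sub>R u) \<bullet> (v + t *\<^sub>R u)) \<le> (v + t *\<^sub>R u) \<bullet> (A *v (v + t *\<^sub>R u))"
      by (rule ge) (use v uW W in \<open>simp add: subspace_add subspace_scale\<close>)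
    ultimately show ?thesis
      using vv uv
      by (simp add: q_def Av matrix_vector_right_distrib matrix_vector_mult_scaleR inner_simps
          power2_eq_square algebra_simps inner_commute c_def[symmetric])
  qed
  have "u \<bullet> u = 0"
  proof (rule ccontr)
    assume "u \<bullet> u \<noteq> 0"
    then have U: "u \<bullet> u > 0" by simp
    \<comment> \<open>A positive majorant of \<open>q\<close>: at
      \<open>t = - (u \<bullet> u) / K\<close> the linear term outweighs the quadratic one.\<close>
    define K where "K = \<bar>q\<bar> + 1"
    have K: "K > 0" "q \<le> K" by (auto simp: K_def)
    have "0 \<le> 2 * (- (u \<bullet> u) / K) * (u \<bullet> u) + (- (u \<bullet> u) / K)\<^sup>2 * q" by (rule q)
    also have "\<dots> \<le> 2 * (- (u \<bullet> u) / K) * (u \<bullet> u) + (- (u \<bullet> u) / K)\<^sup>2 * K"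
      using K by (intro add_left_mono mult_left_mono) auto
    also have "\<dots> = - ((u \<bullet> u)\<^sup>2 / K)"
      using K by (simp add: field_simps power2_eq_square)
    also have "\<dots> < 0" using U K by simp
    finally show False by simp
  qed
  then have "A *v v = c *\<^sub>R v" by (simp add: u_def)
  then show ?thesis using that[of v c] v ge by auto
qed

text \<open>Eigenvectors are collected by induction over sets of indices. By symmetry the orthogonal
  complement \<open>W\<close> of those already found is invariant, and by dimension it is nonzero
  while an index remains, so it contains a further eigenvector.\<close>

lemma symmetric_matrix_spectral:
  fixes A :: "real^'n^'n"
  assumes sym: "transpose A = A"
  obtains f :: "'n \<Rightarrow> real^'n" and d where
    "\<And>i j. f i \<bullet> f j = (if i = j then 1 else 0)" "\<And>i. A *v f i = d i *\<^sub>R f i"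
proof -
  have "\<exists>f d. (\<forall>i\<in>S. \<forall>j\<in>S. f i \<bullet> f j = (if i = j then 1 else 0)) \<and> (\<forall>i\<in>S. A *v f i = d i *\<^sub>R f i)"
    if "finite S" for S :: "'n set"
    using that
  proof (induction S rule: finite_induct)
    case (insert k S)
    then obtain f :: "'n \<Rightarrow> real^'n" and d where
      f: "\<And>i j. i \<in> S \<Longrightarrow> j \<in> S \<Longrightarrow> f i \<bullet> f j = (if i = j then 1 else 0)"
      and d: "\<And>i. i \<in> S \<Longrightarrow> A *v f i = d i *\<^sub>R f i"
      by metis
    define W where "W = {x. \<forall>i\<in>S. f i \<bullet> x = 0}"
    have "dim (f ` S) \<le> card S"
      using dim_le_card'[of "f ` S"] card_image_le[of S f] insert.hyps by simp
    also have "card S < card (insert k S)" using insert.hyps by simp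
    also have "card (insert k S) \<le> CARD('n)" by (rule card_mono) auto
    finally have "dim (f ` S) < DIM(real^'n)" by simp
    then obtain w where w: "w \<noteq> 0" "\<And>y. y \<in> span (f ` S) \<Longrightarrow> orthogonal w y"
      by (rule orthogonal_to_subspace_exists) blast
    have wW: "w \<in> W"
      using w(2) by (auto simp: W_def orthogonal_def inner_commute[of w] intro!: span_base)
    have "subspace W"
      unfolding W_def by (auto simp: subspace_def inner_simps)
    moreover have "A *v x \<in> W" if "x \<in> W" for x
      using that d by (auto simp: W_def symmetric_matrix_inner[OF sym, symmetric])
    ultimately obtain v c where v: "v \<in> W" "norm v = 1" "A *v v = c *\<^sub>R v"
      using symmetric_min_eigenvector[OF sym _ _ wW w(1)] by metis
    then have "v \<bullet> v = 1" "\<And>i. i \<in> S \<Longrightarrow> f i \<bullet> v = 0"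
      by (auto simp: norm_eq_1 W_def)
    then show ?case
      using v f d insert.hyps
      by (intro exI[of _ "f(k := v)"] exI[of _ "d(k := c)"]) (auto simp: inner_commute)
  qed auto
  from this[of UNIV] show ?thesis using that by auto
qed

lemma symmetric_matrix_diagonalization:
  fixes A :: "real^'n^'n"
  assumes "transpose A = A"
  obtains T :: "real^'n \<Rightarrow> real^'n" and d where "orthogonal_transformation T"
    "\<And>z. A *v T z = T (\<chi> i. d i * z $ i)"
proof -
  obtain f :: "'n \<Rightarrow> real^'n" and d where f: "\<And>i j. f i \<bullet> f j = (if i = j then 1 else 0)"
    and d: "\<And>i. A *v f i = d i *\<^sub>R f i"
    using symmetric_matrix_spectral[OF assms] by metis
  define T where "T z = (\<Sum>i\<in>UNIV. z $ i *\<^sub>R f i)" for z :: "real^'n"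
  have lin: "linear T"
    unfolding T_def by (intro linear_compose_sum ballI linearI) (auto simp: scaleR_add_left)
  have "T v \<bullet> T w = (\<Sum>i\<in>UNIV. v $ i * w $ i)" for v w
    by (simp add: T_def inner_sum_left inner_sum_right f if_distrib mult.commute cong: if_cong)
  then have "orthogonal_transformation T"
    using lin by (simp add: orthogonal_transformation_def inner_vec_def)
  moreover have "A *v T z = T (\<chi> i. d i * z $ i)" for z
    by (simp add: T_def linear_sum[OF matrix_vector_mul_linear] matrix_vector_mult_scaleR d mult.commute)
  ultimately show ?thesis using that by blast
qed

text \<open>The minimum \<open>c\<close> of the quadratic form on the unit sphere is an eigenvalue
  and a lower bound of all eigenvalues, so the \<open>LEAST\<close> in \<open>lambda_min\<close>
  really is attained.\<close>

lemma lambda_min_symmetric: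
  fixes A :: "real^'n^'n"
  assumes sym: "transpose A = A"
  shows lambda_min_eigval: "eigval A (lambda_min A)"
    and lambda_min_le_quadratic_form: "lambda_min A * (x \<bullet> x) \<le> x \<bullet> (A *v x)"
proof -
  obtain v c where v: "norm v = 1" "A *v v = c *\<^sub>R v"
    and c: "\<And>x. c * (x \<bullet> x) \<le> x \<bullet> (A *v x)"
    using symmetric_min_eigenvector[OF sym subspace_UNIV, of "axis undefined 1"]
    by (auto simp: axis_eq_0_iff)
  have "lambda_min A = c"
    unfolding lambda_min_def
  proof (rule Least_equality)
    show "eigval A c" using v by (auto simp: eigval_def intro!: exI[of _ v])
    fix y assume "eigval A y"
    then obtain u where u: "u \<noteq> 0" "A *v u = y *\<^sub>R u" by (auto simp: eigval_def)
    then show "c \<le> y" using c[of u] by simp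
  qed
  then show "eigval A (lambda_min A)" "lambda_min A * (x \<bullet> x) \<le> x \<bullet> (A *v x)"
    using v c by (auto simp: eigval_def intro!: exI[of _ v])
qed

lemma lambda_min_pos:
  assumes "sym_posdef A"
  shows "0 < lambda_min A"
proof -
  obtain v where "v \<noteq> 0" "A *v v = lambda_min A *\<^sub>R v"
    using lambda_min_eigval[of A] assms by (auto simp: sym_posdef_def eigval_def)
  then show ?thesis
    using assms inner_ge_zero[of v]
    by (auto simp: sym_posdef_def zero_less_mult_iff not_less[symmetric] dest!: spec[of _ v])
qed

subsection \<open>Orthogonal invariance and moments of the uniform measure on the sphere\<close>

lemma emeasure_unit_ball:
  "emeasure lborel (ball (0::'a::euclidean_space) 1) \<noteq> 0"
  "emeasure lborel (ball (0::'a::euclidean_space) 1) \<noteq> \<infinity>"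
  using emeasure_lborel_ball_finite[of "0::'a" 1] by (auto simp: emeasure_ball less_imp_neq[OF unit_ball_vol_pos, symmetric])

lemma nn_integral_lborel_translation:
  fixes a :: "'a::euclidean_space"
  assumes [measurable]: "f \<in> borel_measurable borel"
  shows "(\<integral>\<^sup>+x. f (a + x) \<partial>lborel) = (\<integral>\<^sup>+x. f x \<partial>lborel)"
proof -
  have "(\<integral>\<^sup>+x. f x \<partial>lborel) = (\<integral>\<^sup>+x. f x \<partial>distr lborel borel ((+) a))"
    by (simp add: lborel_distr_plus)
  also have "\<dots> = (\<integral>\<^sup>+x. f (a + x) \<partial>lborel)" by (subst nn_integral_distr) auto
  finally show ?thesis by simp
qed

lemma borel_measurable_orthogonal_transformation:
  fixes T :: "'a::euclidean_space \<Rightarrow> 'a"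
  assumes "orthogonal_transformation T"
  shows "T \<in> borel_measurable borel"
  using orthogonal_transformation_linear[OF assms]
  by (intro borel_measurable_continuous_onI linear_continuous_on) (simp add: linear_conv_bounded_linear)

text \<open>
  Both \<open>T -` A\<close> and \<open>A\<close> arise from the double integral of the indicator of \<open>T x \<in> A\<close>, \<open>y - T x \<in> ball 0 1\<close>:
  integrate over \<open>y\<close> first, or shift \<open>x\<close> by the preimage of \<open>y\<close> under \<open>T\<close> and integrate over \<open>y\<close> last.
  The change of variables theorem of the library requires a well-ordered index type.
\<close>

lemma emeasure_lborel_orthogonal_vimage:
  fixes T :: "'a::euclidean_space \<Rightarrow> 'a"
  assumes T: "orthogonal_transformation T" and A[measurable]: "A \<in> sets borel"
  shows "emeasure lborel (T -` A) = emeasure lborel A"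
proof -
  have lin: "linear T" by (rule orthogonal_transformation_linear[OF T])
  have [measurable]: "T \<in> borel_measurable borel"
    by (rule borel_measurable_orthogonal_transformation[OF T])
  let ?B = "ball (0::'a) 1"
  have [measurable]: "?B \<in> sets borel" by simp
  have normT: "norm (T x) = norm x" for x by (rule orthogonal_transformation_norm[OF T])
  have trI: "(\<integral>\<^sup>+y. indicator ?B (y - a) \<partial>lborel) = emeasure lborel ?B" for a
  proof -
    have "(indicator ?B :: 'a \<Rightarrow> ennreal) \<in> borel_measurable borel" by measurable
    from nn_integral_lborel_translation[OF this, of "- a"] show ?thesis by simp
  qed
  have "emeasure lborel (T -` A) * emeasure lborel ?B
      = (\<integral>\<^sup>+x. indicator A (T x) * emeasure lborel ?B \<partial>lborel)"
  proof (subst nn_integral_multc)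
    have "(\<integral>\<^sup>+x. indicator A (T x) \<partial>lborel) = (\<integral>\<^sup>+x. indicator (T -` A) x \<partial>lborel)"
      by (intro nn_integral_cong) (simp split: split_indicator)
    also have "\<dots> = emeasure lborel (T -` A)"
      by (rule nn_integral_indicator) (use measurable_sets_borel[of T borel A] in simp)
    finally show "emeasure lborel (T -` A) * emeasure lborel ?B
        = (\<integral>\<^sup>+x. indicator A (T x) \<partial>lborel) * emeasure lborel ?B" by simp
  qed measurable
  also have "\<dots> = (\<integral>\<^sup>+x. (\<integral>\<^sup>+y. indicator A (T x) * indicator ?B (y - T x) \<partial>lborel) \<partial>lborel)"
    by (subst nn_integral_cmult, measurable)
       (simp add: trI)
  also have "\<dots> = (\<integral>\<^sup>+y. (\<integral>\<^sup>+x. indicator A (T x) * indicator ?B (y - T x) \<partial>lborel) \<partial>lborel)"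
    by (rule lborel_pair.Fubini') measurable
  also have "\<dots> = (\<integral>\<^sup>+y. (\<integral>\<^sup>+x. indicator A (T x + y) * indicator ?B (- T x) \<partial>lborel) \<partial>lborel)"
  proof (rule nn_integral_cong)
    fix y
    obtain z where z: "T z = y"
      using orthogonal_transformation_surj[OF T] by (metis surjD)
    show "(\<integral>\<^sup>+x. indicator A (T x) * indicator ?B (y - T x) \<partial>lborel)
        = (\<integral>\<^sup>+x. indicator A (T x + y) * indicator ?B (- T x) \<partial>lborel)"
      using nn_integral_lborel_translation[of "\<lambda>x. indicator A (T x) * indicator ?B (y - T x)" z]
      by (simp add: linear_add[OF lin] z add.commute)
  qed
  also have "\<dots> = (\<integral>\<^sup>+x. (\<integral>\<^sup>+y. indicator A (T x + y) * indicator ?B (- T x) \<partial>lborel) \<partial>lborel)"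
    by (rule lborel_pair.Fubini') measurable
  also have "\<dots> = (\<integral>\<^sup>+x. emeasure lborel A * indicator ?B (- T x) \<partial>lborel)"
    by (subst nn_integral_multc, measurable)
       (use nn_integral_lborel_translation[of "indicator A" "T x" for x] in \<open>simp add: add.commute\<close>)
  also have "\<dots> = emeasure lborel A * (\<integral>\<^sup>+x. indicator ?B x \<partial>lborel)"
    by (subst nn_integral_cmult[symmetric], measurable)
       (auto intro!: nn_integral_cong simp: indicator_def normT)
  also have "\<dots> = emeasure lborel A * emeasure lborel ?B"
    by (simp add: nn_integral_indicator)
  finally have "emeasure lborel (T -` A) * emeasure lborel ?B = emeasure lborel A * emeasure lborel ?B" .
  then have "emeasure lborel (T -` A) * emeasure lborel ?B / emeasure lborel ?B
      = emeasure lborel A * emeasure lborel ?B / emeasure lborel ?B" by simp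
  then show ?thesis
    using emeasure_unit_ball[where 'a='a] by (simp add: ennreal_mult_divide_eq)
qed

lemma distr_lborel_orthogonal:
  fixes T :: "'a::euclidean_space \<Rightarrow> 'a"
  assumes T: "orthogonal_transformation T"
  shows "distr lborel borel T = lborel"
proof (rule measure_eqI)
  fix A assume "A \<in> sets (distr lborel borel T)"
  moreover have "T \<in> borel_measurable borel"
    by (rule borel_measurable_orthogonal_transformation[OF T])
  ultimately show "emeasure (distr lborel borel T) A = emeasure lborel A"
    by (simp add: emeasure_distr emeasure_lborel_orthogonal_vimage[OF T])
qed simp

section \<open>The uniform measure on the sphere: concentration and invariance\<close>

lemma sets_sphere_unif[simp, measurable_cong]: "sets sphere_unif = sets borel"
  by (simp add: sphere_unif_def)

lemma space_sphere_unif[simp]: "space sphere_unif = UNIV"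
  by (simp add: sphere_unif_def)

lemma prob_space_sphere_unif: "prob_space (sphere_unif :: (real^'n) measure)"
  unfolding sphere_unif_def
  by (intro prob_space.prob_space_distr prob_space_uniform_measure emeasure_unit_ball) measurable

lemma AE_sphere_unif_norm: "AE \<theta> in sphere_unif. norm (\<theta>::real^'n) = 1"
proof -
  have "AE x in lborel. x \<noteq> (0::real^'n)"
    by (rule AE_lborel_singleton)
  then have "AE x in uniform_measure lborel (ball 0 1). norm ((x::real^'n) /\<^sub>R norm x) = 1"
    by (intro AE_uniform_measureI) auto
  then show ?thesis
    unfolding sphere_unif_def by (subst AE_distr_iff) auto
qed

text \<open>An orthogonal map preserves Lebesgue measure and the unit ball, and it commutes with the
  radial projection.\<close>

lemma distr_sphere_unif_orthogonal:
  fixes T :: "real^'n \<Rightarrow> real^'n"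
  assumes T: "orthogonal_transformation T"
  shows "distr sphere_unif borel T = sphere_unif"
proof -
  let ?U = "uniform_measure lborel (ball (0::real^'n) 1)"
  have lin: "linear T" by (rule orthogonal_transformation_linear[OF T])
  have [measurable]: "T \<in> borel_measurable borel"
    by (rule borel_measurable_orthogonal_transformation[OF T])
  have U: "distr ?U borel T = ?U"
  proof (rule measure_eqI)
    fix A assume "A \<in> sets (distr ?U borel T)"
    then have A[measurable]: "A \<in> sets borel" by simp
    have "T -` A \<in> sets borel" by (rule measurable_sets_borel[OF _ A]) measurable
    moreover have "ball 0 1 \<inter> T -` A = T -` (ball 0 1 \<inter> A)"
      using orthogonal_transformation_norm[OF T] by auto
    ultimately show "emeasure (distr ?U borel T) A = emeasure ?U A"
      using emeasure_lborel_orthogonal_vimage[OF T, of "ball 0 1 \<inter> A"]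
      by (simp add: emeasure_distr)
  qed simp
  have "distr sphere_unif borel T = distr ?U borel (\<lambda>x. T (x /\<^sub>R norm x))"
    unfolding sphere_unif_def by (subst distr_distr) (auto simp: o_def)
  also have "\<dots> = distr ?U borel (\<lambda>x. T x /\<^sub>R norm (T x))"
    by (simp add: linear_scale[OF lin] orthogonal_transformation_norm[OF T])
  also have "\<dots> = distr (distr ?U borel T) borel (\<lambda>x. x /\<^sub>R norm x)"
    by (subst distr_distr) (auto simp: o_def)
  finally show ?thesis unfolding U by (simp add: sphere_unif_def)
qed

lemma integrable_sphere_unif:
  fixes f :: "real^'n \<Rightarrow> 'b::{banach, second_countable_topology}"
  assumes "f \<in> borel_measurable borel" "\<And>\<theta>. norm \<theta> = 1 \<Longrightarrow> norm (f \<theta>) \<le> C"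
  shows "integrable sphere_unif f"
proof -
  interpret prob_space "sphere_unif :: (real^'n) measure" by (rule prob_space_sphere_unif)
  show ?thesis
    by (rule integrable_const_bound[of _ C]) (use assms AE_sphere_unif_norm in auto)
qed

section \<open>Second and fourth moments of the sphere\<close>

lemma abs_inner_le_norm_sphere: "norm \<theta> = 1 \<Longrightarrow> \<bar>u \<bullet> \<theta>\<bar> \<le> norm u"
  using Cauchy_Schwarz_ineq2[of u \<theta>] by simp

text \<open>A rotation reduces every direction \<open>u\<close> to one fixed axis, so in each degree
  a single constant is unknown. In degrees 2 and 4 it is found below by summing over the axes and
  using that the norm is 1 almost everywhere.\<close>

lemma integral_sphere_unif_power:
  fixes u :: "real^'n"
  shows "(\<integral>\<theta>. (u \<bullet> \<theta>)^p \<partial>sphere_unif) = norm u ^ p * (\<integral>\<theta>. ((axis undefined 1 :: real^'n) \<bullet> \<theta>)^p \<partial>sphere_unif)"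
proof -
  let ?a = "norm u *\<^sub>R axis undefined 1 :: real^'n"
  have "norm ?a = norm u" by simp
  then obtain T :: "real^'n \<Rightarrow> real^'n" where T: "orthogonal_transformation T" "T ?a = u"
    by (rule orthogonal_transformation_exists)
  have [measurable]: "T \<in> borel_measurable borel"
    by (rule borel_measurable_orthogonal_transformation) (rule T)
  have "(\<integral>\<theta>. (u \<bullet> \<theta>)^p \<partial>sphere_unif) = (\<integral>\<theta>. (u \<bullet> \<theta>)^p \<partial>distr sphere_unif borel T)"
    by (simp add: distr_sphere_unif_orthogonal[OF T(1)])
  also have "\<dots> = (\<integral>\<theta>. (u \<bullet> T \<theta>)^p \<partial>sphere_unif)"
    by (rule integral_distr) auto
  also have "\<dots> = (\<integral>\<theta>. (?a \<bullet> \<theta>)^p \<partial>sphere_unif)"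
    using T by (metis orthogonal_transformation_def)
  finally show ?thesis by (simp add: power_mult_distrib)
qed

lemma sum_axis_inner_squared: "(\<Sum>i\<in>UNIV. (axis i 1 \<bullet> x)\<^sup>2) = (norm (x::real^'n))\<^sup>2"
  by (simp only: inner_axis' power2_norm_eq_inner) (simp add: inner_vec_def power2_eq_square)

lemma inner_axis_axis_1: "(axis i 1 :: real^'n) \<bullet> axis j 1 = (if i = j then 1 else 0)"
  by (simp add: inner_axis_axis)

lemma integral_sphere_unif_inner_inner:
  fixes u v :: "real^'n"
  shows "(\<integral>\<theta>. (u \<bullet> \<theta>) * (v \<bullet> \<theta>) \<partial>sphere_unif) = (u \<bullet> v) / real CARD('n)"
proof -
  let ?I = "\<lambda>f. \<integral>\<theta>. f \<theta> \<partial>(sphere_unif :: (real^'n) measure)"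
  define c where "c = ?I (\<lambda>\<theta>. (axis undefined 1 \<bullet> \<theta>)\<^sup>2)"
  have Q: "?I (\<lambda>\<theta>. (w \<bullet> \<theta>)\<^sup>2) = c * (w \<bullet> w)" for w
    unfolding c_def by (subst integral_sphere_unif_power) (simp add: power2_norm_eq_inner)
  have int: "integrable sphere_unif (\<lambda>\<theta>. (w \<bullet> \<theta>)\<^sup>2)" for w :: "real^'n"
    by (rule integrable_sphere_unif[where C="(norm w)\<^sup>2"])
       (auto intro!: abs_le_square_iff[THEN iffD1] abs_inner_le_norm_sphere)
  interpret prob_space "sphere_unif :: (real^'n) measure" by (rule prob_space_sphere_unif)
  have "c * real CARD('n) = (\<Sum>i\<in>UNIV. ?I (\<lambda>\<theta>. (axis i 1 \<bullet> \<theta>)\<^sup>2))"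
    by (simp add: Q inner_axis_axis_1)
  also have "\<dots> = ?I (\<lambda>\<theta>. (\<Sum>i\<in>UNIV. (axis i 1 \<bullet> \<theta>)\<^sup>2))"
    by (simp add: Bochner_Integration.integral_sum int)
  also have "\<dots> = ?I (\<lambda>\<theta>. 1)"
    by (intro integral_cong_AE) (use AE_sphere_unif_norm in \<open>auto simp: sum_axis_inner_squared\<close>)
  finally have c: "c * real CARD('n) = 1" using prob_space by simp
  have "?I (\<lambda>\<theta>. (u \<bullet> \<theta>) * (v \<bullet> \<theta>)) = ?I (\<lambda>\<theta>. (((u + v) \<bullet> \<theta>)\<^sup>2 - ((u - v) \<bullet> \<theta>)\<^sup>2) / 4)"
    by (intro Bochner_Integration.integral_cong refl) (simp only: inner_add_left inner_diff_left, algebra)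
  also have "\<dots> = (c * ((u + v) \<bullet> (u + v)) - c * ((u - v) \<bullet> (u - v))) / 4"
    by (simp add: int Q)
  also have "\<dots> = c * (u \<bullet> v)"
    by (simp only: inner_add_left inner_diff_left inner_add_right inner_diff_right inner_commute[of v u]) algebra
  finally show ?thesis using c by (simp add: field_simps)
qed

text \<open>The three summands are the pairings of four vectors, as in Wick's formula for Gaussian
  moments. Polarization leads from the pure fourth power to two distinct vectors
  (\<open>M2\<close>), then three (\<open>M3\<close>), then four (\<open>M\<close>).\<close>

lemma integral_sphere_unif_inner4:
  fixes a b c d :: "real^'n"
  shows "(\<integral>\<theta>. (a \<bullet> \<theta>) * (b \<bullet> \<theta>) * (c \<bullet> \<theta>) * (d \<bullet> \<theta>) \<partial>sphere_unif)
    = ((a \<bullet> b) * (c \<bullet> d) + (a \<bullet> c) * (b \<bullet> d) + (a \<bullet> d) * (b \<bullet> c)) / (real CARD('n) * (real CARD('n) + 2))"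
proof -
  let ?I = "\<lambda>f. \<integral>\<theta>. f \<theta> \<partial>(sphere_unif :: (real^'n) measure)"
  \<comment> \<open>A third of the fourth moment of a coordinate, because the three pairings agree
    when all four vectors coincide.\<close>
  define K where "K = ?I (\<lambda>\<theta>. (axis undefined 1 \<bullet> \<theta>)^4) / 3"
  have Q: "?I (\<lambda>\<theta>. (w \<bullet> \<theta>) * (w \<bullet> \<theta>) * (w \<bullet> \<theta>) * (w \<bullet> \<theta>)) = 3 * K * (w \<bullet> w)\<^sup>2" for w
    using integral_sphere_unif_power[of w 4]
    by (simp add: K_def power4_eq_xxxx power2_norm_eq_inner[symmetric] power2_eq_square mult_ac)
  have int: "integrable sphere_unif (\<lambda>\<theta>. (a \<bullet> \<theta>) * (b \<bullet> \<theta>) * (c \<bullet> \<theta>) * (d \<bullet> \<theta>))"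
    for a b c d :: "real^'n"
    by (rule integrable_sphere_unif[where C="norm a * norm b * norm c * norm d"])
       (auto simp: abs_mult intro!: mult_mono abs_inner_le_norm_sphere)
  have M2: "?I (\<lambda>\<theta>. (a \<bullet> \<theta>) * (a \<bullet> \<theta>) * (b \<bullet> \<theta>) * (b \<bullet> \<theta>)) = K * ((a \<bullet> a) * (b \<bullet> b) + 2 * (a \<bullet> b)\<^sup>2)"
    for a b :: "real^'n"
  proof -
    let ?p = "a + b" and ?q = "a - b"
    \<comment> \<open>Polarization by \<open>12 * x\<^sup>2 * y\<^sup>2 = (x + y)^4 + (x - y)^4 - 2
      * x^4 - 2 * y^4\<close>.\<close>
    have "?I (\<lambda>\<theta>. 12 * ((a \<bullet> \<theta>) * (a \<bullet> \<theta>) * (b \<bullet> \<theta>) * (b \<bullet> \<theta>)))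
      = ?I (\<lambda>\<theta>. (?p \<bullet> \<theta>) * (?p \<bullet> \<theta>) * (?p \<bullet> \<theta>) * (?p \<bullet> \<theta>) + (?q \<bullet> \<theta>) * (?q \<bullet> \<theta>) * (?q \<bullet> \<theta>) * (?q \<bullet> \<theta>)
          - 2 * ((a \<bullet> \<theta>) * (a \<bullet> \<theta>) * (a \<bullet> \<theta>) * (a \<bullet> \<theta>)) - 2 * ((b \<bullet> \<theta>) * (b \<bullet> \<theta>) * (b \<bullet> \<theta>) * (b \<bullet> \<theta>)))"
      by (intro Bochner_Integration.integral_cong refl) (simp only: inner_add_left inner_diff_left, algebra)
    also have "\<dots> = 3 * K * (?p \<bullet> ?p)\<^sup>2 + 3 * K * (?q \<bullet> ?q)\<^sup>2 - 2 * (3 * K * (a \<bullet> a)\<^sup>2) - 2 * (3 * K * (b \<bullet> b)\<^sup>2)"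
      by (simp add: int Q)
    also have "\<dots> = 12 * (K * ((a \<bullet> a) * (b \<bullet> b) + 2 * (a \<bullet> b)\<^sup>2))"
      by (simp only: inner_add_left inner_diff_left inner_add_right inner_diff_right inner_commute[of b a]) algebra
    finally show ?thesis by simp
  qed
  have M3: "?I (\<lambda>\<theta>. (a \<bullet> \<theta>) * (a \<bullet> \<theta>) * (b \<bullet> \<theta>) * (c \<bullet> \<theta>))
      = K * ((a \<bullet> a) * (b \<bullet> c) + 2 * (a \<bullet> b) * (a \<bullet> c))"
    for a b c :: "real^'n"
  proof -
    let ?p = "b + c" and ?q = "b - c"
    have "?I (\<lambda>\<theta>. 4 * ((a \<bullet> \<theta>) * (a \<bullet> \<theta>) * (b \<bullet> \<theta>) * (c \<bullet> \<theta>)))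
      = ?I (\<lambda>\<theta>. (a \<bullet> \<theta>) * (a \<bullet> \<theta>) * (?p \<bullet> \<theta>) * (?p \<bullet> \<theta>) - (a \<bullet> \<theta>) * (a \<bullet> \<theta>) * (?q \<bullet> \<theta>) * (?q \<bullet> \<theta>))"
      by (intro Bochner_Integration.integral_cong refl) (simp only: inner_add_left inner_diff_left, algebra)
    also have "\<dots> = K * ((a \<bullet> a) * (?p \<bullet> ?p) + 2 * (a \<bullet> ?p)\<^sup>2) - K * ((a \<bullet> a) * (?q \<bullet> ?q) + 2 * (a \<bullet> ?q)\<^sup>2)"
      by (simp add: int M2)
    also have "\<dots> = 4 * (K * ((a \<bullet> a) * (b \<bullet> c) + 2 * (a \<bullet> b) * (a \<bullet> c)))"
      by (simp only: inner_add_left inner_diff_left inner_add_right inner_diff_right inner_commute[of c b]) algebra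
    finally show ?thesis by simp
  qed
  have M: "?I (\<lambda>\<theta>. (a \<bullet> \<theta>) * (b \<bullet> \<theta>) * (c \<bullet> \<theta>) * (d \<bullet> \<theta>))
      = K * ((a \<bullet> b) * (c \<bullet> d) + (a \<bullet> c) * (b \<bullet> d) + (a \<bullet> d) * (b \<bullet> c))" for a b c d :: "real^'n"
  proof -
    let ?p = "a + b" and ?q = "a - b"
    have "?I (\<lambda>\<theta>. 4 * ((a \<bullet> \<theta>) * (b \<bullet> \<theta>) * (c \<bullet> \<theta>) * (d \<bullet> \<theta>)))
      = ?I (\<lambda>\<theta>. (?p \<bullet> \<theta>) * (?p \<bullet> \<theta>) * (c \<bullet> \<theta>) * (d \<bullet> \<theta>) - (?q \<bullet> \<theta>) * (?q \<bullet> \<theta>) * (c \<bullet> \<theta>) * (d \<bullet> \<theta>))"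
      by (intro Bochner_Integration.integral_cong refl) (simp only: inner_add_left inner_diff_left, algebra)
    also have "\<dots> = K * ((?p \<bullet> ?p) * (c \<bullet> d) + 2 * (?p \<bullet> c) * (?p \<bullet> d)) - K * ((?q \<bullet> ?q) * (c \<bullet> d) + 2 * (?q \<bullet> c) * (?q \<bullet> d))"
      by (simp add: int M3)
    also have "\<dots> = 4 * (K * ((a \<bullet> b) * (c \<bullet> d) + (a \<bullet> c) * (b \<bullet> d) + (a \<bullet> d) * (b \<bullet> c)))"
      by (simp only: inner_add_left inner_diff_left inner_add_right inner_diff_right inner_commute[of b a]) algebra
    finally show ?thesis by simp
  qed
  interpret prob_space "sphere_unif :: (real^'n) measure" by (rule prob_space_sphere_unif)
  let ?n = "real CARD('n)"
  \<comment> \<open>The fourth power of the norm is expanded over ordered pairs of axes. Each of the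
    \<open>n\<close> diagonal pairs contributes \<open>3 * K\<close>, every other pair
    \<open>K\<close>.\<close>
  have "K * (?n * (?n + 2)) = (\<Sum>i\<in>(UNIV::'n set). \<Sum>j\<in>UNIV. K * (1 + 2 * (if i = j then 1 else 0)))"
    by (simp add: sum_distrib_left[symmetric] sum.distrib algebra_simps)
  also have "\<dots> = (\<Sum>i\<in>UNIV. \<Sum>j\<in>UNIV. ?I (\<lambda>\<theta>. (axis i 1 \<bullet> \<theta>) * (axis i 1 \<bullet> \<theta>) * (axis j 1 \<bullet> \<theta>) * (axis j 1 \<bullet> \<theta>)))"
    by (intro sum.cong refl) (simp only: M2 inner_axis_axis_1, simp)
  also have "\<dots> = ?I (\<lambda>\<theta>. (\<Sum>i\<in>UNIV. (axis i 1 \<bullet> \<theta>)\<^sup>2) * (\<Sum>j\<in>UNIV. (axis j 1 \<bullet> \<theta>)\<^sup>2))"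
    by (simp only: sum_product power2_eq_square)
      (simp add: Bochner_Integration.integral_sum int mult.assoc[symmetric])
  also have "\<dots> = ?I (\<lambda>\<theta>. 1)"
    by (intro integral_cong_AE) (use AE_sphere_unif_norm in \<open>auto simp: sum_axis_inner_squared\<close>)
  finally have "K * (?n * (?n + 2)) = 1" using prob_space by simp
  moreover have "?n * (?n + 2) > 0" by simp
  ultimately have "K = 1 / (?n * (?n + 2))" by (simp add: field_simps)
  then show ?thesis by (simp add: M)
qed

lemma quadratic_form_eq_sum:
  fixes D :: "real^'n^'n"
  shows "\<theta> \<bullet> (D *v \<theta>) = (\<Sum>i\<in>UNIV. \<Sum>j\<in>UNIV. D $ i $ j * ((axis i 1 \<bullet> \<theta>) * (axis j 1 \<bullet> \<theta>)))"
  by (simp add: inner_vec_def[of \<theta>] matrix_vector_mult_def inner_axis' sum_distrib_left mult_ac)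

lemma integral_sphere_unif_quadratic_form:
  fixes D :: "real^'n^'n"
  shows "(\<integral>\<theta>. \<theta> \<bullet> (D *v \<theta>) \<partial>sphere_unif) = trace D / real CARD('n)"
proof -
  have int: "integrable sphere_unif (\<lambda>\<theta>. (axis i 1 \<bullet> \<theta>) * (axis j 1 \<bullet> \<theta>))" for i j :: 'n
    by (rule integrable_sphere_unif[where C="1"])
       (auto simp: abs_mult intro!: mult_le_one order_trans[OF abs_inner_le_norm_sphere])
  show ?thesis
    unfolding quadratic_form_eq_sum
    by (simp add: Bochner_Integration.integral_sum int integral_sphere_unif_inner_inner inner_axis_axis_1
        trace_def sum_divide_distrib[symmetric] if_distrib[of "\<lambda>x. _ * x"] cong: if_cong)
qed

text \<open>One pairing of the four indices gives the squared trace, another the sum of the squared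
  entries. The third gives the sum of \<open>D $ i $ j * D $ j $ i\<close>, which symmetry turns
  into the second.\<close>

lemma integral_sphere_unif_quadratic_form_squared:
  fixes D :: "real^'n^'n"
  assumes sym: "transpose D = D"
  shows "(\<integral>\<theta>. (\<theta> \<bullet> (D *v \<theta>))\<^sup>2 \<partial>sphere_unif)
    = ((trace D)\<^sup>2 + 2 * (norm D)\<^sup>2) / (real CARD('n) * (real CARD('n) + 2))"
proof -
  let ?x = "\<lambda>i \<theta>. axis i 1 \<bullet> (\<theta>::real^'n)"
  let ?\<delta> = "\<lambda>i j::'n. if i = j then 1 else 0 :: real"
  have delta: "x * (if P then 1 else 0) = (if P then x else 0)" for x :: real and P
    by simp
  define N where "N = real CARD('n) * (real CARD('n) + 2)"
  have int: "integrable sphere_unif (\<lambda>\<theta>. ?x i \<theta> * ?x j \<theta> * ?x k \<theta> * ?x l \<theta>)" for i j k l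
    by (rule integrable_sphere_unif[where C="1"])
       (auto simp: abs_mult intro!: mult_le_one order_trans[OF abs_inner_le_norm_sphere])
  have symD: "D $ j $ i = D $ i $ j" for i j
    using arg_cong[OF sym, of "\<lambda>A. A $ i $ j"] by (simp add: transpose_def)
  have "(\<integral>\<theta>. (\<theta> \<bullet> (D *v \<theta>))\<^sup>2 \<partial>sphere_unif)
     = (\<integral>\<theta>. (\<Sum>i\<in>UNIV. \<Sum>j\<in>UNIV. \<Sum>k\<in>UNIV. \<Sum>l\<in>UNIV. D $ i $ j * D $ k $ l *
         (?x i \<theta> * ?x j \<theta> * ?x k \<theta> * ?x l \<theta>)) \<partial>sphere_unif)"
    unfolding quadratic_form_eq_sum power2_eq_square
    by (simp only: sum_distrib_right) (simp only: sum_distrib_left mult_ac)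
  also have "\<dots> = (\<Sum>i\<in>UNIV. \<Sum>j\<in>UNIV. \<Sum>k\<in>UNIV. \<Sum>l\<in>UNIV. D $ i $ j * D $ k $ l *
         ((?\<delta> i j * ?\<delta> k l + ?\<delta> i k * ?\<delta> j l + ?\<delta> i l * ?\<delta> j k) / N))"
    by (simp add: Bochner_Integration.integral_sum int integral_sphere_unif_inner4 inner_axis_axis_1 N_def)
  also have "\<dots> = ((\<Sum>i\<in>UNIV. \<Sum>j\<in>UNIV. \<Sum>k\<in>UNIV. \<Sum>l\<in>UNIV. D $ i $ j * D $ k $ l * ?\<delta> i j * ?\<delta> k l)
      + (\<Sum>i\<in>UNIV. \<Sum>j\<in>UNIV. \<Sum>k\<in>UNIV. \<Sum>l\<in>UNIV. D $ i $ j * D $ k $ l * ?\<delta> i k * ?\<delta> j l)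
      + (\<Sum>i\<in>UNIV. \<Sum>j\<in>UNIV. \<Sum>k\<in>UNIV. \<Sum>l\<in>UNIV. D $ i $ j * D $ k $ l * ?\<delta> j k * ?\<delta> i l)) / N"
    by (simp only: sum.distrib[symmetric] sum_divide_distrib distrib_left times_divide_eq_right mult_ac)
  also have "(\<Sum>i\<in>UNIV. \<Sum>j\<in>UNIV. \<Sum>k\<in>UNIV. \<Sum>l\<in>UNIV. D $ i $ j * D $ k $ l * ?\<delta> i j * ?\<delta> k l) = (trace D)\<^sup>2"
  proof -
    have "(\<Sum>i\<in>UNIV. \<Sum>j\<in>UNIV. \<Sum>k\<in>UNIV. \<Sum>l\<in>UNIV. D $ i $ j * D $ k $ l * ?\<delta> i j * ?\<delta> k l)
        = (\<Sum>i\<in>UNIV. \<Sum>j\<in>UNIV. D $ i $ j * ?\<delta> i j) * (\<Sum>k\<in>UNIV. \<Sum>l\<in>UNIV. D $ k $ l * ?\<delta> k l)"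
      by (simp only: sum_distrib_right) (simp only: sum_distrib_left mult_ac)
    then show ?thesis by (simp add: delta trace_def power2_eq_square)
  qed
  also have "(\<Sum>i\<in>UNIV. \<Sum>j\<in>UNIV. \<Sum>k\<in>UNIV. \<Sum>l\<in>UNIV. D $ i $ j * D $ k $ l * ?\<delta> i k * ?\<delta> j l) = (norm D)\<^sup>2"
    by (simp add: delta power2_norm_eq_inner inner_vec_def)
  also have "(\<Sum>i\<in>UNIV. \<Sum>j\<in>UNIV. \<Sum>k\<in>UNIV. \<Sum>l\<in>UNIV. D $ i $ j * D $ k $ l * ?\<delta> j k * ?\<delta> i l) = (norm D)\<^sup>2"
    by (simp add: delta power2_norm_eq_inner inner_vec_def symD[symmetric])
  finally show ?thesis by (simp add: N_def)
qed

subsection \<open>Slices of Gaussian laws\<close>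

lemma nn_integral_lborel_orthogonal:
  fixes T :: "'a::euclidean_space \<Rightarrow> 'a"
  assumes T: "orthogonal_transformation T" and [measurable]: "f \<in> borel_measurable borel"
  shows "(\<integral>\<^sup>+x. f (T x) \<partial>lborel) = (\<integral>\<^sup>+x. f x \<partial>lborel)"
proof -
  have [measurable]: "T \<in> borel_measurable borel" by (rule borel_measurable_orthogonal_transformation[OF T])
  have "(\<integral>\<^sup>+x. f x \<partial>lborel) = (\<integral>\<^sup>+x. f x \<partial>distr lborel borel T)"
    by (simp add: distr_lborel_orthogonal[OF T])
  also have "\<dots> = (\<integral>\<^sup>+x. f (T x) \<partial>lborel)" by (subst nn_integral_distr) auto
  finally show ?thesis by simp
qed

section \<open>The standard Gaussian and its one-dimensional marginals\<close>

abbreviation std_normal :: "real measure" where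
  "std_normal \<equiv> density lborel (\<lambda>x. ennreal (std_normal_density x))"

text \<open>The product form makes integrals of functions of one coordinate factorize over the
  basis; the closed form in \<open>std_gaussian_density\<close> exhibits the invariance under
  rotations. Together they give the law of \<open>u \<bullet> x\<close>.\<close>

definition std_gaussian :: "'a::euclidean_space measure" where
  "std_gaussian = density lborel (\<lambda>x. \<Prod>b\<in>Basis. ennreal (std_normal_density (x \<bullet> b)))"

lemma std_gaussian_density:
  "(\<Prod>b\<in>Basis. ennreal (std_normal_density (x \<bullet> b)))
    = ennreal (exp (- (x \<bullet> x) / 2) / sqrt ((2 * pi) ^ DIM('a)))" for x :: "'a::euclidean_space"
proof -
  have "(\<Prod>b\<in>Basis. std_normal_density (x \<bullet> b)) = (1 / sqrt (2 * pi)) ^ DIM('a) * exp (\<Sum>b\<in>Basis. - (x \<bullet> b)\<^sup>2 / 2)"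
    by (simp add: std_normal_density_def prod.distrib exp_sum prod_dividef power_one_over)
  also have "(\<Sum>b\<in>Basis. - (x \<bullet> b)\<^sup>2 / 2) = - (x \<bullet> x) / 2"
    using euclidean_inner[of x x]
    by (simp add: sum_negf sum_divide_distrib power2_eq_square)
  also have "(1 / sqrt (2 * pi)) ^ DIM('a) * exp (- (x \<bullet> x) / 2) = exp (- (x \<bullet> x) / 2) / sqrt ((2 * pi) ^ DIM('a))"
    by (simp add: real_sqrt_power power_one_over real_sqrt_mult power_mult_distrib)
  finally show ?thesis
    by (simp add: prod_ennreal)
qed

lemma sets_std_gaussian[simp, measurable_cong]: "sets std_gaussian = sets borel"
  by (simp add: std_gaussian_def)

lemma nn_integral_std_gaussian:
  fixes f :: "'a::euclidean_space \<Rightarrow> ennreal"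
  assumes "f \<in> borel_measurable borel"
  shows "(\<integral>\<^sup>+x. f x \<partial>std_gaussian)
    = (\<integral>\<^sup>+x. ennreal (exp (- (x \<bullet> x) / 2) / sqrt ((2 * pi) ^ DIM('a))) * f x \<partial>lborel)"
  unfolding std_gaussian_def std_gaussian_density
  by (rule nn_integral_density) (use assms in auto)

lemma nn_integral_std_gaussian_orthogonal:
  fixes T :: "'a::euclidean_space \<Rightarrow> 'a"
  assumes T: "orthogonal_transformation T" and [measurable]: "f \<in> borel_measurable borel"
  shows "(\<integral>\<^sup>+x. f (T x) \<partial>std_gaussian) = (\<integral>\<^sup>+x. f x \<partial>std_gaussian)"
proof -
  have [measurable]: "T \<in> borel_measurable borel" by (rule borel_measurable_orthogonal_transformation[OF T])
  have TT: "T x \<bullet> T x = x \<bullet> x" for x using T by (simp add: orthogonal_transformation_def)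
  show ?thesis
    using nn_integral_lborel_orthogonal[OF T,
        of "\<lambda>x. ennreal (exp (- (x \<bullet> x) / 2) / sqrt ((2 * pi) ^ DIM('a))) * f x"]
    by (simp add: nn_integral_std_gaussian TT)
qed

lemma nn_integral_std_normal_1: "(\<integral>\<^sup>+x. ennreal (std_normal_density x) \<partial>lborel) = 1"
  by (subst nn_integral_eq_integral) auto

lemma nn_integral_std_gaussian_Basis:
  fixes e :: "'a::euclidean_space"
  assumes e: "e \<in> Basis" and [measurable]: "f \<in> borel_measurable borel"
  shows "(\<integral>\<^sup>+x. f (e \<bullet> x) \<partial>std_gaussian) = (\<integral>\<^sup>+z. f z \<partial>std_normal)"
proof -
  let ?g = "\<lambda>b y. ennreal (std_normal_density y) * (if b = e then f y else 1)"
  have "(\<integral>\<^sup>+x. f (e \<bullet> x) \<partial>std_gaussian) = (\<integral>\<^sup>+x. (\<Prod>b\<in>Basis. ?g b (x \<bullet> b)) \<partial>lborel)"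
    unfolding std_gaussian_def
    by (subst nn_integral_density) (auto simp: prod.distrib e inner_commute)
  also have "\<dots> = (\<Prod>b\<in>Basis. \<integral>\<^sup>+y. ?g b y \<partial>lborel)"
    by (rule nn_integral_lborel_prod) auto
  also have "\<dots> = (\<Prod>b\<in>Basis. if b = e then \<integral>\<^sup>+z. f z \<partial>std_normal else 1)"
    by (intro prod.cong refl) (auto simp: nn_integral_density nn_integral_std_normal_1)
  finally show ?thesis using e by simp
qed

lemma nn_integral_std_gaussian_inner:
  fixes u :: "real^'n"
  assumes [measurable]: "f \<in> borel_measurable borel"
  shows "(\<integral>\<^sup>+x. f (u \<bullet> x) \<partial>std_gaussian) = (\<integral>\<^sup>+z. f (norm u * z) \<partial>std_normal)"
proof -
  let ?e = "axis undefined 1 :: real^'n"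
  have "norm (norm u *\<^sub>R ?e) = norm u" by simp
  then obtain T :: "real^'n \<Rightarrow> real^'n" where T: "orthogonal_transformation T" "T (norm u *\<^sub>R ?e) = u"
    by (rule orthogonal_transformation_exists)
  have "(\<integral>\<^sup>+x. f (u \<bullet> x) \<partial>std_gaussian) = (\<integral>\<^sup>+x. f (u \<bullet> T x) \<partial>std_gaussian)"
    by (rule nn_integral_std_gaussian_orthogonal[OF T(1), symmetric]) measurable
  also have "\<dots> = (\<integral>\<^sup>+x. f (norm u * (?e \<bullet> x)) \<partial>std_gaussian)"
  proof -
    have "u \<bullet> T x = norm u * (?e \<bullet> x)" for x
      using T unfolding orthogonal_transformation_def by (metis inner_scaleR_left)
    then show ?thesis by simp
  qed
  also have "(\<integral>\<^sup>+x. f (norm u * (?e \<bullet> x)) \<partial>std_gaussian) = (\<integral>\<^sup>+z. f (norm u * z) \<partial>std_normal)"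
    by (rule nn_integral_std_gaussian_Basis[of ?e "\<lambda>y. f (norm u * y)"]) (auto simp: axis_in_Basis_iff)
  finally show ?thesis .
qed

section \<open>Coordinatewise scaling and Gaussians with general covariance\<close>

lemma Basis_vec_eq_range: "(Basis :: (real^'n) set) = range (\<lambda>i. axis i 1)"
  by (auto simp: Basis_vec_def)

lemma prod_Basis_vec: "(\<Prod>b\<in>(Basis :: (real^'n) set). g b) = (\<Prod>i\<in>UNIV. g (axis i 1))"
  unfolding Basis_vec_eq_range by (subst prod.reindex) (auto simp: inj_on_def axis_eq_axis)

lemma sum_Basis_vec: "(\<Sum>b\<in>(Basis :: (real^'n) set). g b) = (\<Sum>i\<in>UNIV. g (axis i 1))"
  unfolding Basis_vec_eq_range by (subst sum.reindex) (auto simp: inj_on_def axis_eq_axis)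

lemma nn_integral_lborel_stretch:
  fixes c :: "'n::finite \<Rightarrow> real"
  assumes c: "\<And>i. 0 < c i" and [measurable]: "f \<in> borel_measurable borel"
  shows "(\<integral>\<^sup>+x. f x \<partial>lborel) = (\<integral>\<^sup>+z. ennreal (\<Prod>i\<in>UNIV. c i) * f (\<chi> i. c i * z $ i) \<partial>lborel)"
proof -
  \<comment> \<open>The scaling factors are transferred from indices to basis vectors, as
    \<open>lborel_affine_euclidean\<close> expects them.\<close>
  define C where "C b = c (THE i. b = axis i (1::real))" for b :: "real^'n"
  have C: "C (axis i 1) = c i" for i
    unfolding C_def by (subst the_equality[where a=i]) (auto simp: axis_eq_axis)
  have "C b \<noteq> 0" if "b \<in> Basis" for b
    using that c by (auto simp: Basis_vec_eq_range C less_imp_neq[symmetric])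
  note lborel_affine_euclidean[where c=C and t=0, OF this]
  moreover have "(\<Prod>b\<in>Basis. \<bar>C b\<bar>) = (\<Prod>i\<in>UNIV. c i)"
    using c by (simp add: prod_Basis_vec C less_imp_le)
  moreover have "0 + (\<Sum>b\<in>Basis. (C b * (z \<bullet> b)) *\<^sub>R b) = (\<chi> i. c i * z $ i)" for z
  proof -
    have "0 + (\<Sum>b\<in>Basis. (C b * (z \<bullet> b)) *\<^sub>R b) = (\<Sum>i\<in>UNIV. (c i * z $ i) *\<^sub>R axis i 1)"
      by (simp add: sum_Basis_vec C inner_axis)
    then show ?thesis
      by (simp add: vec_eq_iff axis_def if_distrib[of "\<lambda>x. _ * x"] cong: if_cong)
  qed
  ultimately have eq: "lborel = density (distr lborel borel (\<lambda>z. \<chi> i. c i * z $ i))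
      (\<lambda>_. ennreal (\<Prod>i\<in>UNIV. c i))"
    by simp
  have [measurable]: "(\<lambda>z. \<chi> i. c i * z $ i) \<in> borel_measurable borel"
    by (rule borel_measurable_continuous_onI, rule continuous_on_vec_lambda, intro continuous_intros)
  have "(\<integral>\<^sup>+x. f x \<partial>lborel) = (\<integral>\<^sup>+x. f x \<partial>density (distr lborel borel (\<lambda>z. \<chi> i. c i * z $ i))
      (\<lambda>_. ennreal (\<Prod>i\<in>UNIV. c i)))"
    using eq by (rule arg_cong)
  also have "\<dots> = (\<integral>\<^sup>+x. ennreal (\<Prod>i\<in>UNIV. c i) * f x \<partial>distr lborel borel (\<lambda>z. \<chi> i. c i * z $ i))"
    by (rule nn_integral_density) measurable
  also have "\<dots> = (\<integral>\<^sup>+z. ennreal (\<Prod>i\<in>UNIV. c i) * f (\<chi> i. c i * z $ i) \<partial>lborel)"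
    by (rule nn_integral_distr) measurable
  finally show ?thesis .
qed

text \<open>The substitution \<open>x = m + T (S z)\<close>, with \<open>T\<close> diagonalizing
  \<open>A\<close> and \<open>S\<close> scaling by the roots of the eigenvalues, standardizes the
  law, and its Jacobian cancels \<open>sqrt (det A)\<close>. The integrand sees \<open>z\<close>
  only through \<open>u \<bullet> z\<close> with
  \<open>norm u = sqrt (\<theta> \<bullet> (A *v \<theta>))\<close>, which leaves an integral over
  the line.\<close>

lemma nn_integral_gaussian:
  fixes m :: "real^'n"
  assumes A: "sym_posdef A" and [measurable]: "h \<in> borel_measurable borel"
  shows "(\<integral>\<^sup>+x. h (\<theta> \<bullet> x) \<partial>gaussian m A)
    = (\<integral>\<^sup>+z. h (\<theta> \<bullet> m + sqrt (\<theta> \<bullet> (A *v \<theta>)) * z) \<partial>std_normal)"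
proof -
  have sym: "transpose A = A" and pos: "\<And>x. x \<noteq> 0 \<Longrightarrow> 0 < x \<bullet> (A *v x)"
    using A by (auto simp: sym_posdef_def)
  obtain T :: "real^'n \<Rightarrow> real^'n" and d where T: "orthogonal_transformation T"
    and AT: "\<And>z. A *v T z = T (\<chi> i. d i * z $ i)"
    using symmetric_matrix_diagonalization[OF sym] by blast
  have lin: "linear T" by (rule orthogonal_transformation_linear[OF T])
  have TT: "T v \<bullet> T w = v \<bullet> w" for v w using T by (simp add: orthogonal_transformation_def)
  have dpos: "0 < d i" for i
  proof -
    have "T (axis i 1) \<noteq> 0"
      using orthogonal_transformation_norm[OF T, of "axis i 1"] by auto
    from pos[OF this] show ?thesis by (simp add: AT TT inner_axis')
  qed
  have [measurable]: "T \<in> borel_measurable borel" by (rule borel_measurable_orthogonal_transformation[OF T])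
  \<comment> \<open>Matrices enter to identify \<open>det A\<close> with the product of the
    eigenvalues: taking determinants in \<open>A ** Q = Q ** ?D\<close>, the factor
    \<open>det Q\<close> cancels.\<close>
  define Q where "Q = matrix T"
  have "orthogonal_matrix Q" using T by (simp add: Q_def orthogonal_transformation_matrix)
  then have detQ: "det Q \<noteq> 0"
    using det_orthogonal_matrix[of Q] by auto
  let ?D = "(\<chi> i j. if i = j then d i else 0) :: real^'n^'n"
  have "A ** Q = Q ** ?D"
    unfolding matrix_eq
  proof
    fix z
    have D: "?D *v z = (\<chi> i. d i * z $ i)"
      by (simp add: matrix_vector_mult_def vec_eq_iff if_distrib[of "\<lambda>x. x * _"] cong: if_cong)
    have Q: "Q *v z = T z" for z
      unfolding Q_def using fun_cong[OF matrix_vector_mul(2)[OF lin]] .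
    show "(A ** Q) *v z = (Q ** ?D) *v z"
      by (simp only: matrix_vector_mul_assoc[symmetric] D Q AT)
  qed
  from arg_cong[where f=det, OF this] have "det A * det Q = det Q * det ?D"
    by (simp only: det_mul)
  also have "det ?D = (\<Prod>i\<in>UNIV. d i)"
    by (subst det_diagonal) auto
  finally have "det A * det Q = det Q * (\<Prod>i\<in>UNIV. d i)" .
  then have detA: "det A = (\<Prod>i\<in>UNIV. d i)" using detQ by simp
  then have "det A > 0" using dpos by (simp add: prod_pos)
  then have "invertible A" by (simp add: invertible_det_nz)
  then have "matrix_inv A ** A = mat 1"
    unfolding invertible_def matrix_inv_def by (rule someI2_ex) simp
  then have inv: "matrix_inv A *v (A *v x) = x" for x
    by (simp add: matrix_vector_mul_assoc)
  let ?c = "\<lambda>i. sqrt (d i)"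
  define S where "S z = (\<chi> i. ?c i * z $ i)" for z :: "real^'n"
  have [measurable]: "S \<in> borel_measurable borel"
    unfolding S_def by (rule borel_measurable_continuous_onI, rule continuous_on_vec_lambda, intro continuous_intros)
  have quad: "T (S z) \<bullet> (matrix_inv A *v T (S z)) = z \<bullet> z" for z
  proof -
    \<comment> \<open>This exhibits \<open>T (S z)\<close> as an image under \<open>A\<close>, so
      that \<open>matrix_inv A\<close> merely undoes \<open>A\<close> and its entries are never
      computed.\<close>
    have "d i * (z $ i / ?c i) = ?c i * z $ i" for i
      using real_div_sqrt[of "d i"] dpos[of i] by (simp add: field_simps)
    then have "T (S z) = A *v T (\<chi> i. z $ i / ?c i)"
      by (simp add: AT S_def)
    then have "T (S z) \<bullet> (matrix_inv A *v T (S z)) = T (S z) \<bullet> T (\<chi> i. z $ i / ?c i)"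
      using inv by metis
    also have "\<dots> = S z \<bullet> (\<chi> i. z $ i / ?c i)"
      using T by (simp add: orthogonal_transformation_def)
    also have "\<dots> = z \<bullet> z"
      using dpos by (simp add: S_def inner_vec_def less_imp_neq[symmetric])
    finally show ?thesis .
  qed
  obtain y where y: "\<theta> = T y" using orthogonal_transformation_surj[OF T] by (metis surjD)
  define u where "u = (\<chi> i. ?c i * y $ i)"
  have inner_u: "\<theta> \<bullet> T (S z) = u \<bullet> z" for z
    unfolding y TT by (simp add: S_def u_def inner_vec_def mult_ac)
  have "?c i * y $ i * (?c i * y $ i) = y $ i * (d i * y $ i)" for i
    using real_sqrt_mult_self[of "d i"] dpos[of i] by (simp add: mult_ac flip: mult.assoc[of "?c i" "?c i"])
  then have "u \<bullet> u = y \<bullet> (\<chi> i. d i * y $ i)"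
    unfolding inner_vec_def u_def by (simp only: vec_lambda_beta inner_real_def)
  then have norm_u: "norm u = sqrt (\<theta> \<bullet> (A *v \<theta>))"
    by (simp only: y AT TT norm_eq_sqrt_inner)
  let ?g = "\<lambda>x. ennreal (exp (- ((x - m) \<bullet> (matrix_inv A *v (x - m))) / 2) / sqrt ((2 * pi) ^ CARD('n) * det A))"
  have "continuous_on UNIV (\<lambda>x. (x - m) \<bullet> (matrix_inv A *v (x - m)))"
    by (intro continuous_intros bounded_linear.continuous_on[OF matrix_vector_mul_bounded_linear])
  then have [measurable]: "(\<lambda>x. (x - m) \<bullet> (matrix_inv A *v (x - m))) \<in> borel_measurable borel"
    by (rule borel_measurable_continuous_onI)
  have [measurable]: "?g \<in> borel_measurable borel"
    by measurable
  have "(\<integral>\<^sup>+x. h (\<theta> \<bullet> x) \<partial>gaussian m A) = (\<integral>\<^sup>+x. ?g x * h (\<theta> \<bullet> x) \<partial>lborel)"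
    unfolding gaussian_def by (subst nn_integral_density) auto
  also have "\<dots> = (\<integral>\<^sup>+x. ?g (m + x) * h (\<theta> \<bullet> (m + x)) \<partial>lborel)"
    by (rule nn_integral_lborel_translation[symmetric]) measurable
  also have "\<dots> = (\<integral>\<^sup>+x. ?g (m + T x) * h (\<theta> \<bullet> (m + T x)) \<partial>lborel)"
    by (rule nn_integral_lborel_orthogonal[OF T, symmetric]) measurable
  also have "\<dots> = (\<integral>\<^sup>+z. ennreal (\<Prod>i\<in>UNIV. ?c i) * (?g (m + T (S z)) * h (\<theta> \<bullet> (m + T (S z)))) \<partial>lborel)"
    unfolding S_def
  proof (rule nn_integral_lborel_stretch)
    show "(\<lambda>x. ?g (m + T x) * h (\<theta> \<bullet> (m + T x))) \<in> borel_measurable borel" by measurable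
  qed (use dpos in auto)
  also have "\<dots> = (\<integral>\<^sup>+z. ennreal (exp (- (z \<bullet> z) / 2) / sqrt ((2 * pi) ^ DIM(real^'n))) * h (\<theta> \<bullet> m + u \<bullet> z) \<partial>lborel)"
  proof (intro nn_integral_cong)
    fix z :: "real^'n"
    define P where "P = (\<Prod>i\<in>UNIV. ?c i)"
    have "sqrt (det A) = P"
      unfolding detA P_def by (induction rule: infinite_finite_induct) (auto simp: real_sqrt_mult)
    moreover have "P > 0" using dpos by (simp add: P_def prod_pos)
    ultimately have "ennreal P * ?g (m + T (S z))
        = ennreal (exp (- (z \<bullet> z) / 2) / sqrt ((2 * pi) ^ DIM(real^'n)))"
      by (subst ennreal_mult[symmetric]) (auto simp: quad real_sqrt_mult less_imp_le)
    then show "ennreal (\<Prod>i\<in>UNIV. ?c i) * (?g (m + T (S z)) * h (\<theta> \<bullet> (m + T (S z))))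
        = ennreal (exp (- (z \<bullet> z) / 2) / sqrt ((2 * pi) ^ DIM(real^'n))) * h (\<theta> \<bullet> m + u \<bullet> z)"
      by (simp add: P_def[symmetric] mult.assoc[symmetric] inner_add_right inner_u)
  qed
  also have "\<dots> = (\<integral>\<^sup>+z. h (\<theta> \<bullet> m + u \<bullet> z) \<partial>std_gaussian)"
    by (rule nn_integral_std_gaussian[symmetric]) measurable
  also have "\<dots> = (\<integral>\<^sup>+z. h (\<theta> \<bullet> m + norm u * z) \<partial>std_normal)"
    by (rule nn_integral_std_gaussian_inner[of "\<lambda>y. h (\<theta> \<bullet> m + y)"]) measurable
  finally show ?thesis by (simp add: norm_u)
qed

text \<open>Affine images of one common \<open>std_normal\<close> are the convenient form here,
  since driving two slices by the same variable \<open>z\<close> is then an optimal coupling of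
  them.\<close>

lemma slice_gaussian:
  fixes m :: "real^'n"
  assumes "sym_posdef A"
  shows "slice (gaussian m A) \<theta> = distr std_normal borel (\<lambda>z. \<theta> \<bullet> m + sqrt (\<theta> \<bullet> (A *v \<theta>)) * z)"
proof (rule measure_eqI)
  fix X assume "X \<in> sets (slice (gaussian m A) \<theta>)"
  then have [measurable]: "X \<in> sets borel" by (simp add: slice_def)
  have [measurable]: "(\<lambda>x. \<theta> \<bullet> x) \<in> borel_measurable (gaussian m A)"
    by (simp add: gaussian_def)
  have "emeasure (slice (gaussian m A) \<theta>) X = (\<integral>\<^sup>+x. indicator X (\<theta> \<bullet> x) \<partial>gaussian m A)"
    unfolding slice_def by (subst nn_integral_distr[symmetric, of _ _ borel]) (auto simp flip: nn_integral_indicator)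
  also have "\<dots> = (\<integral>\<^sup>+z. indicator X (\<theta> \<bullet> m + sqrt (\<theta> \<bullet> (A *v \<theta>)) * z) \<partial>std_normal)"
    by (rule nn_integral_gaussian[OF assms]) measurable
  also have "\<dots> = emeasure (distr std_normal borel (\<lambda>z. \<theta> \<bullet> m + sqrt (\<theta> \<bullet> (A *v \<theta>)) * z)) X"
    by (subst nn_integral_distr[symmetric, of _ _ borel]) (auto simp flip: nn_integral_indicator)
  finally show "emeasure (slice (gaussian m A) \<theta>) X
    = emeasure (distr std_normal borel (\<lambda>z. \<theta> \<bullet> m + sqrt (\<theta> \<bullet> (A *v \<theta>)) * z)) X" .
qed (simp add: slice_def)

subsection \<open>Quadratic Wasserstein distance on the line\<close>

lemma std_normal_quadratic:
  "has_bochner_integral std_normal (\<lambda>z. p + q * z + r * z\<^sup>2) (p + r)"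
proof -
  have "has_bochner_integral lborel (\<lambda>z. std_normal_density z * z ^ (2 * 0)) 1"
    "has_bochner_integral lborel (\<lambda>z. std_normal_density z * z ^ (2 * 0 + 1)) 0"
    "has_bochner_integral lborel (\<lambda>z. std_normal_density z * z ^ (2 * 1)) 1"
    using std_normal_moment_even[of 0] std_normal_moment_odd[of 0] std_normal_moment_even[of 1]
    by simp_all
  then have "has_bochner_integral lborel (\<lambda>z. std_normal_density z * z ^ (2 * 0) * p
      + std_normal_density z * z ^ (2 * 0 + 1) * q + std_normal_density z * z ^ (2 * 1) * r)
      (1 * p + 0 * q + 1 * r)"
    by (intro has_bochner_integral_add has_bochner_integral_mult_left) auto
  then have "has_bochner_integral lborel (\<lambda>z. std_normal_density z *\<^sub>R (p + q * z + r * z\<^sup>2)) (p + r)"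
    by (simp add: algebra_simps power2_eq_square)
  then show ?thesis
    by (intro has_bochner_integral_density) auto
qed

text \<open>The coupling \<open>\<pi>\<close> that drives both marginals by the same
  \<open>z\<close> gives the upper bound. The lower bound is weak Kantorovich duality: potentials
  with \<open>g x + h y \<le> (dist x y)\<^sup>2\<close> have integrals that depend on the marginals
  alone, and these add up to the claimed value.\<close>

lemma W2_squared_std_normal_affine:
  fixes a b s t :: real
  assumes s: "0 < s" and t: "0 < t"
  shows "W2_squared (distr std_normal borel (\<lambda>z. a + s * z)) (distr std_normal borel (\<lambda>z. b + t * z))
    = ennreal ((a - b)\<^sup>2 + (s - t)\<^sup>2)"
    (is "W2_squared ?\<mu> ?\<nu> = ennreal ?w")
proof (rule antisym)
  define \<pi> where "\<pi> = distr std_normal (borel \<Otimes>\<^sub>M borel) (\<lambda>z. (a + s * z, b + t * z))"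
  have "sets \<pi> = sets (?\<mu> \<Otimes>\<^sub>M ?\<nu>)"
    unfolding \<pi>_def by (auto intro!: sets_pair_measure_cong)
  moreover have "distr \<pi> ?\<mu> fst = ?\<mu>"
  proof -
    have "distr \<pi> ?\<mu> fst = distr \<pi> borel fst" by (rule distr_cong) auto
    also have "\<dots> = ?\<mu>" unfolding \<pi>_def by (subst distr_distr) (auto simp: o_def)
    finally show ?thesis .
  qed
  moreover have "distr \<pi> ?\<nu> snd = ?\<nu>"
  proof -
    have "distr \<pi> ?\<nu> snd = distr \<pi> borel snd" by (rule distr_cong) auto
    also have "\<dots> = ?\<nu>" unfolding \<pi>_def by (subst distr_distr) (auto simp: o_def)
    finally show ?thesis .
  qed
  ultimately have "\<pi> \<in> couplings ?\<mu> ?\<nu>" by (simp add: couplings_def)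
  then have "W2_squared ?\<mu> ?\<nu> \<le> (\<integral>\<^sup>+ z. ennreal ((dist (fst z) (snd z))\<^sup>2) \<partial>\<pi>)"
    unfolding W2_squared_def by (rule INF_lower)
  also have "\<dots> = (\<integral>\<^sup>+ z. ennreal (((a - b) + (s - t) * z)\<^sup>2) \<partial>std_normal)"
    unfolding \<pi>_def by (subst nn_integral_distr) (auto simp: dist_real_def algebra_simps)
  also have "\<dots> = ennreal ?w"
  proof (rule nn_integral_eq_integral[THEN trans])
    have "(\<lambda>z. ((a - b) + (s - t) * z)\<^sup>2) = (\<lambda>z. (a - b)\<^sup>2 + 2 * (a - b) * (s - t) * z + (s - t)\<^sup>2 * z\<^sup>2)"
      by (simp add: power2_eq_square algebra_simps)
    then have "has_bochner_integral std_normal (\<lambda>z. ((a - b) + (s - t) * z)\<^sup>2) ?w"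
      using std_normal_quadratic by simp
    then show "integrable std_normal (\<lambda>z. ((a - b) + (s - t) * z)\<^sup>2)"
      "ennreal (\<integral>z. ((a - b) + (s - t) * z)\<^sup>2 \<partial>std_normal) = ennreal ?w"
      by (auto simp: has_bochner_integral_iff)
  qed auto
  finally show "W2_squared ?\<mu> ?\<nu> \<le> ennreal ?w" .
next
  show "ennreal ?w \<le> W2_squared ?\<mu> ?\<nu>"
    unfolding W2_squared_def
  proof (rule INF_greatest)
    fix \<pi> assume "\<pi> \<in> couplings ?\<mu> ?\<nu>"
    then have sets: "sets \<pi> = sets (?\<mu> \<Otimes>\<^sub>M ?\<nu>)" and d1: "distr \<pi> ?\<mu> fst = ?\<mu>" and d2: "distr \<pi> ?\<nu> snd = ?\<nu>"
      by (auto simp: couplings_def)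
    have "sets (?\<mu> \<Otimes>\<^sub>M ?\<nu>) = sets (borel \<Otimes>\<^sub>M borel)"
      by (intro sets_pair_measure_cong) auto
    with sets have [measurable_cong]: "sets \<pi> = sets (borel \<Otimes>\<^sub>M borel)" by simp
    \<comment> \<open>Quadratic potentials that make the dual inequality sharp on the optimal line
      \<open>(x - a) / s = (y - b) / t\<close>; the slack is
      \<open>(t * X - s * Y)\<^sup>2 / (s * t)\<close> with \<open>X = x - a\<close> and
      \<open>Y = y - b\<close>.\<close>
    define g where "g x = (a - b)\<^sup>2 + 2 * (a - b) * (x - a) + (1 - t / s) * (x - a)\<^sup>2" for x
    define h where "h y = - 2 * (a - b) * (y - b) + (1 - s / t) * (y - b)\<^sup>2" for y
    have [measurable]: "g \<in> borel_measurable borel" "h \<in> borel_measurable borel"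
      unfolding g_def[abs_def] h_def[abs_def] by measurable
    have "has_bochner_integral std_normal (\<lambda>z. g (a + s * z)) ((a - b)\<^sup>2 + (1 - t / s) * s\<^sup>2)"
      using std_normal_quadratic[of "(a - b)\<^sup>2" "2 * (a - b) * s" "(1 - t / s) * s\<^sup>2"]
      by (simp add: g_def power_mult_distrib mult_ac)
    then have "has_bochner_integral (distr \<pi> ?\<mu> fst) g ((a - b)\<^sup>2 + (1 - t / s) * s\<^sup>2)"
      unfolding d1 by (intro has_bochner_integral_distr) auto
    then have G: "has_bochner_integral \<pi> (\<lambda>z. g (fst z)) ((a - b)\<^sup>2 + (1 - t / s) * s\<^sup>2)"
      by (subst (asm) has_bochner_integral_iff)
         (auto simp: has_bochner_integral_iff integral_distr integrable_distr_eq)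
    have "has_bochner_integral std_normal (\<lambda>z. h (b + t * z)) (0 + (1 - s / t) * t\<^sup>2)"
      using std_normal_quadratic[of 0 "- 2 * (a - b) * t" "(1 - s / t) * t\<^sup>2"]
      by (simp add: h_def power_mult_distrib mult_ac)
    then have "has_bochner_integral (distr \<pi> ?\<nu> snd) h (0 + (1 - s / t) * t\<^sup>2)"
      unfolding d2 by (intro has_bochner_integral_distr) auto
    then have Hh: "has_bochner_integral \<pi> (\<lambda>z. h (snd z)) (0 + (1 - s / t) * t\<^sup>2)"
      by (subst (asm) has_bochner_integral_iff)
         (auto simp: has_bochner_integral_iff integral_distr integrable_distr_eq)
    have "(a - b)\<^sup>2 + (1 - t / s) * s\<^sup>2 + (0 + (1 - s / t) * t\<^sup>2) = ?w"
      using s t by (simp add: field_simps power2_eq_square)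
    with has_bochner_integral_add[OF G Hh]
    have GH: "has_bochner_integral \<pi> (\<lambda>z. g (fst z) + h (snd z)) ?w" by (simp only:)
    have ge: "g x + h y \<le> (dist x y)\<^sup>2" for x y :: real
    proof -
      define X Y where "X = x - a" and "Y = y - b"
      have "(dist x y)\<^sup>2 - (g x + h y) = (t * X - s * Y)\<^sup>2 / (s * t)"
        using s t unfolding g_def h_def dist_real_def power2_abs X_def Y_def
        by (simp add: field_simps power2_eq_square)
      also have "\<dots> \<ge> 0" using s t by simp
      finally show ?thesis by simp
    qed
    show "ennreal ?w \<le> (\<integral>\<^sup>+ z. ennreal ((dist (fst z) (snd z))\<^sup>2) \<partial>\<pi>)" (is "_ \<le> ?N")
    proof (cases "?N = \<infinity>")
      case False
      have int: "integrable \<pi> (\<lambda>z. (dist (fst z) (snd z))\<^sup>2)"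
        by (rule integrableI_nonneg) (use False in \<open>auto simp: less_top\<close>)
      then have "?w \<le> (\<integral>z. (dist (fst z) (snd z))\<^sup>2 \<partial>\<pi>)"
        using GH ge integral_mono[of \<pi> "\<lambda>z. g (fst z) + h (snd z)" "\<lambda>z. (dist (fst z) (snd z))\<^sup>2"]
        by (auto simp: has_bochner_integral_iff)
      then show ?thesis
        by (subst nn_integral_eq_integral[OF int]) (auto intro: ennreal_leI simp del: ennreal_plus)
    qed simp
  qed
qed

subsection \<open>The sliced distance of Gaussian laws and its gradient\<close>

lemma symmetric_quadratic_form_spectral:
  fixes A :: "real^'n^'n"
  assumes "transpose A = A"
  obtains f :: "'n \<Rightarrow> real^'n" and d where "\<And>i. norm (f i) = 1" "\<And>i. A *v f i = d i *\<^sub>R f i"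
    "\<And>x. x \<bullet> (A *v x) = (\<Sum>i\<in>UNIV. d i * (f i \<bullet> x)\<^sup>2)"
proof -
  obtain T :: "real^'n \<Rightarrow> real^'n" and d where T: "orthogonal_transformation T"
    and AT: "\<And>z. A *v T z = T (\<chi> i. d i * z $ i)"
    using symmetric_matrix_diagonalization[OF assms] by blast
  have TT: "T v \<bullet> T w = v \<bullet> w" for v w using T by (simp add: orthogonal_transformation_def)
  define f where "f i = T (axis i 1)" for i
  have "x \<bullet> (A *v x) = (\<Sum>i\<in>UNIV. d i * (f i \<bullet> x)\<^sup>2)" for x
  proof -
    obtain z where z: "x = T z" using orthogonal_transformation_surj[OF T] by (metis surjD)
    have fx: "f i \<bullet> x = z $ i" for i
      by (simp add: z f_def TT inner_axis')
    show ?thesis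
      unfolding fx unfolding z AT TT by (simp add: inner_vec_def power2_eq_square mult_ac)
  qed
  moreover have "A *v f i = d i *\<^sub>R f i" for i
  proof -
    have "(\<chi> j. d j * axis i 1 $ j) = d i *\<^sub>R axis i 1"
      by (simp add: vec_eq_iff axis_def)
    then show ?thesis
      by (simp add: f_def AT orthogonal_transformation_scaleR[OF T])
  qed
  moreover have "norm (f i) = 1" for i by (simp add: f_def orthogonal_transformation_norm[OF T])
  ultimately show ?thesis using that by blast
qed

lemma inner_mat_1: "(mat 1 :: real^'n^'n) \<bullet> X = trace X"
  by (simp add: inner_vec_def mat_def trace_def if_distrib[of "\<lambda>x. x * _"] cong: if_cong)

lemma continuous_on_quadratic_form[continuous_intros]:
  "continuous_on S (\<lambda>\<theta>::real^'n. \<theta> \<bullet> (A *v \<theta>))"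
  by (intro continuous_intros matrix_vector_mult_linear_continuous_on)

lemma borel_measurable_quadratic_form[measurable]:
  "(\<lambda>\<theta>::real^'n. \<theta> \<bullet> (A *v \<theta>)) \<in> borel_measurable borel"
  by (intro borel_measurable_continuous_onI continuous_on_quadratic_form)

lemma continuous_on_outer[continuous_intros]: "continuous_on S (outer :: real^'n \<Rightarrow> real^'n^'n)"
  unfolding outer_def[abs_def]
  by (rule continuous_on_vec_lambda, rule continuous_on_vec_lambda, intro continuous_intros)

lemma borel_measurable_outer[measurable]: "(outer :: real^'n \<Rightarrow> real^'n^'n) \<in> borel_measurable borel"
  by (intro borel_measurable_continuous_onI continuous_on_outer)

lemma integrable_sphere_unif_continuous:
  fixes f :: "real^'n \<Rightarrow> 'b::{banach, second_countable_topology}"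
  assumes "f \<in> borel_measurable borel" "continuous_on (sphere 0 1) f"
  shows "integrable sphere_unif f"
proof -
  have "bounded (f ` sphere 0 1)"
    using assms(2) by (intro compact_imp_bounded compact_continuous_image) auto
  then obtain C where "\<forall>x\<in>f ` sphere 0 1. norm x \<le> C"
    unfolding bounded_iff by blast
  then show ?thesis
    by (intro integrable_sphere_unif[OF assms(1), of C]) auto
qed

lemma integral_sphere_unif_mono:
  fixes f g :: "real^'n \<Rightarrow> real"
  assumes "integrable sphere_unif f" "integrable sphere_unif g"
    "\<And>\<theta>. norm \<theta> = 1 \<Longrightarrow> f \<theta> \<le> g \<theta>"
  shows "(\<integral>\<theta>. f \<theta> \<partial>sphere_unif) \<le> (\<integral>\<theta>. g \<theta> \<partial>sphere_unif)"
  by (rule integral_mono_AE) (use assms AE_sphere_unif_norm in auto)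

lemma sym_posdef_quadratic_form_bounds:
  fixes A :: "real^'n^'n"
  assumes A: "sym_posdef A" and \<theta>: "norm \<theta> = 1"
  shows "lambda_min A \<le> \<theta> \<bullet> (A *v \<theta>)" "\<theta> \<bullet> (A *v \<theta>) \<le> trace A" "0 < \<theta> \<bullet> (A *v \<theta>)"
proof -
  have sym: "transpose A = A" using A by (simp add: sym_posdef_def)
  have "\<theta> \<bullet> \<theta> = 1" using \<theta> by (simp add: norm_eq_1)
  then show "lambda_min A \<le> \<theta> \<bullet> (A *v \<theta>)" using lambda_min_le_quadratic_form[OF sym, of \<theta>] by simp
  then show "0 < \<theta> \<bullet> (A *v \<theta>)" using lambda_min_pos[OF A] by simp
  obtain f :: "'n \<Rightarrow> real^'n" and d where f: "\<And>i. norm (f i) = 1" and d: "\<And>i. A *v f i = d i *\<^sub>R f i"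
    and q: "\<And>x. x \<bullet> (A *v x) = (\<Sum>i\<in>UNIV. d i * (f i \<bullet> x)\<^sup>2)"
    using symmetric_quadratic_form_spectral[OF sym] by blast
  have dpos: "0 \<le> d i" for i
  proof -
    have "f i \<noteq> 0" using f[of i] by auto
    then have "0 < f i \<bullet> (A *v f i)" using A by (simp add: sym_posdef_def)
    then show ?thesis using f[of i] by (simp add: d norm_eq_1)
  qed
  have int: "integrable sphere_unif (\<lambda>\<theta>. (f i \<bullet> \<theta>) * (f i \<bullet> \<theta>))" for i
    by (rule integrable_sphere_unif_continuous) (auto intro!: continuous_intros)
  \<comment> \<open>Integrating the quadratic form over the sphere in two ways shows that the trace
    is the sum of the eigenvalues: each unit eigenvector contributes a second moment
    \<open>1 / n\<close>.\<close>
  have "trace A = real CARD('n) * (\<integral>\<theta>. \<theta> \<bullet> (A *v \<theta>) \<partial>sphere_unif)"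
    by (simp add: integral_sphere_unif_quadratic_form)
  also have "\<dots> = (\<Sum>i\<in>UNIV. d i)"
    using f integral_sphere_unif_inner_inner[of "f i" "f i" for i]
    by (simp add: q Bochner_Integration.integral_sum int power2_eq_square norm_eq_1 sum_divide_distrib[symmetric])
  finally have tr: "trace A = (\<Sum>i\<in>UNIV. d i)" .
  have "d i * (f i \<bullet> \<theta>)\<^sup>2 \<le> d i" for i
    using abs_inner_le_norm_sphere[OF \<theta>, of "f i"] f[of i] dpos[of i]
    by (intro mult_left_le) (auto simp: abs_square_le_1)
  then show "\<theta> \<bullet> (A *v \<theta>) \<le> trace A"
    unfolding q tr by (rule sum_mono)
qed

lemma lambda_min_le_trace:
  assumes "sym_posdef (A :: real^'n^'n)"
  shows "lambda_min A \<le> trace A"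
proof -
  have "norm (axis undefined 1 :: real^'n) = 1" by simp
  from sym_posdef_quadratic_form_bounds(1,2)[OF assms this] show ?thesis by simp
qed

text \<open>The function called \<open>F\<close> in the overview. For positive definite
  \<open>A\<close> and \<open>B\<close> it is the squared sliced distance of two Gaussian laws with
  equal means.\<close>

definition sliced_gap :: "real^'n^'n \<Rightarrow> real^'n^'n \<Rightarrow> real" where
  "sliced_gap A B = (\<integral>\<theta>. (sqrt (\<theta> \<bullet> (A *v \<theta>)) - sqrt (\<theta> \<bullet> (B *v \<theta>)))\<^sup>2 \<partial>sphere_unif)"

lemma integrable_sliced_gap:
  "integrable sphere_unif (\<lambda>\<theta>. (sqrt (\<theta> \<bullet> (A *v \<theta>)) - sqrt (\<theta> \<bullet> (B *v \<theta>)))\<^sup>2)"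
  by (rule integrable_sphere_unif_continuous) (measurable, intro continuous_intros)

lemma integrable_quadratic_form: "integrable sphere_unif (\<lambda>\<theta>. \<theta> \<bullet> (A *v \<theta>))"
  by (rule integrable_sphere_unif_continuous) (measurable, intro continuous_intros)

lemma sliced_gap_nonneg: "0 \<le> sliced_gap A B"
  unfolding sliced_gap_def by (rule Bochner_Integration.integral_nonneg) simp

lemma SW2_gaussian:
  fixes m m' :: "real^'n"
  assumes A: "sym_posdef A" and B: "sym_posdef B"
  shows "(SW2 (gaussian m A) (gaussian m' B))\<^sup>2 = (norm (m - m'))\<^sup>2 / real CARD('n) + sliced_gap A B"
    and "0 \<le> SW2 (gaussian m A) (gaussian m' B)"
proof -
  let ?f = "\<lambda>\<theta>. ((m - m') \<bullet> \<theta>) * ((m - m') \<bullet> \<theta>)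
    + (sqrt (\<theta> \<bullet> (A *v \<theta>)) - sqrt (\<theta> \<bullet> (B *v \<theta>)))\<^sup>2"
  have i1: "integrable sphere_unif (\<lambda>\<theta>. ((m - m') \<bullet> \<theta>) * ((m - m') \<bullet> \<theta>))"
    by (rule integrable_sphere_unif_continuous) (measurable, intro continuous_intros)
  have "SW2_squared (gaussian m A) (gaussian m' B) = (\<integral>\<^sup>+ \<theta>. ennreal (?f \<theta>) \<partial>sphere_unif)"
    unfolding SW2_squared_def
  proof (rule nn_integral_cong_AE)
    show "AE \<theta> in sphere_unif. W2_squared (slice (gaussian m A) \<theta>) (slice (gaussian m' B) \<theta>) = ennreal (?f \<theta>)"
      using AE_sphere_unif_norm
    proof eventually_elim
      case (elim \<theta>)
      have "0 < \<theta> \<bullet> (A *v \<theta>)" "0 < \<theta> \<bullet> (B *v \<theta>)"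
        using sym_posdef_quadratic_form_bounds(3)[OF _ elim] A B by auto
      then have "W2_squared (slice (gaussian m A) \<theta>) (slice (gaussian m' B) \<theta>)
          = ennreal ((\<theta> \<bullet> m - \<theta> \<bullet> m')\<^sup>2 + (sqrt (\<theta> \<bullet> (A *v \<theta>)) - sqrt (\<theta> \<bullet> (B *v \<theta>)))\<^sup>2)"
        by (simp only: slice_gaussian[OF A] slice_gaussian[OF B] W2_squared_std_normal_affine real_sqrt_gt_0_iff)
      then show ?case
        by (simp only: inner_diff_left inner_commute[of \<theta>] power2_eq_square[of "m \<bullet> \<theta> - m' \<bullet> \<theta>"])
    qed
  qed
  also have "\<dots> = ennreal (\<integral>\<theta>. ?f \<theta> \<partial>sphere_unif)"
    by (rule nn_integral_eq_integral) (auto intro!: Bochner_Integration.integrable_add i1 integrable_sliced_gap)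
  also have "(\<integral>\<theta>. ?f \<theta> \<partial>sphere_unif) = (norm (m - m'))\<^sup>2 / real CARD('n) + sliced_gap A B"
    using i1 by (simp add: integrable_sliced_gap sliced_gap_def integral_sphere_unif_inner_inner power2_norm_eq_inner)
  finally show "(SW2 (gaussian m A) (gaussian m' B))\<^sup>2 = (norm (m - m'))\<^sup>2 / real CARD('n) + sliced_gap A B"
    "0 \<le> SW2 (gaussian m A) (gaussian m' B)"
    using sliced_gap_nonneg[of A B] by (auto simp: SW2_def simp del: ennreal_plus)
qed

text \<open>The matrix \<open>(1 / n) *\<^sub>R mat 1\<close> is the second moment matrix of the
  sphere; absorbing it into the integral produces the \<open>- 1\<close>. All later arguments use
  \<open>H_mat\<close> through such pairings, which reduce matrix statements to scalar ones at each
  \<theta>.\<close>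

lemma H_mat_inner:
  fixes A B X :: "real^'n^'n"
  assumes A: "sym_posdef A"
  shows "H_mat B A \<bullet> X
    = (\<integral>\<theta>. (sqrt ((\<theta> \<bullet> (B *v \<theta>)) / (\<theta> \<bullet> (A *v \<theta>))) - 1) * (\<theta> \<bullet> (X *v \<theta>)) \<partial>sphere_unif)"
    and integrable_H_mat:
      "integrable sphere_unif (\<lambda>\<theta>. (sqrt ((\<theta> \<bullet> (B *v \<theta>)) / (\<theta> \<bullet> (A *v \<theta>))) - 1) * (\<theta> \<bullet> (X *v \<theta>)))"
proof -
  let ?s = "\<lambda>\<theta>. sqrt ((\<theta> \<bullet> (B *v \<theta>)) / (\<theta> \<bullet> (A *v \<theta>)))"
  have ne: "\<theta> \<bullet> (A *v \<theta>) \<noteq> 0" if "\<theta> \<in> sphere 0 1" for \<theta>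
    using sym_posdef_quadratic_form_bounds(3)[OF A, of \<theta>] that by simp
  have i1: "integrable sphere_unif (\<lambda>\<theta>. ?s \<theta> *\<^sub>R outer \<theta>)"
    by (rule integrable_sphere_unif_continuous) (measurable, intro continuous_intros ballI ne)
  have i2: "integrable sphere_unif (\<lambda>\<theta>. ?s \<theta> * (\<theta> \<bullet> (X *v \<theta>)))"
    by (rule integrable_sphere_unif_continuous) (measurable, intro continuous_intros ballI ne)
  show "integrable sphere_unif (\<lambda>\<theta>. (?s \<theta> - 1) * (\<theta> \<bullet> (X *v \<theta>)))"
    using i2 integrable_quadratic_form[of X] by (simp add: left_diff_distrib)
  have "H_mat B A \<bullet> X = (\<integral>\<theta>. ?s \<theta> *\<^sub>R outer \<theta> \<partial>sphere_unif) \<bullet> X - trace X / real CARD('n)"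
    by (simp add: H_mat_def inner_diff_left inner_mat_1)
  also have "(\<integral>\<theta>. ?s \<theta> *\<^sub>R outer \<theta> \<partial>sphere_unif) \<bullet> X = (\<integral>\<theta>. ?s \<theta> * (\<theta> \<bullet> (X *v \<theta>)) \<partial>sphere_unif)"
    by (subst integral_inner_left[OF i1, symmetric]) (simp add: inner_outer)
  also have "\<dots> - trace X / real CARD('n) = (\<integral>\<theta>. (?s \<theta> - 1) * (\<theta> \<bullet> (X *v \<theta>)) \<partial>sphere_unif)"
    using i2 integrable_quadratic_form[of X]
    by (simp add: left_diff_distrib integral_sphere_unif_quadratic_form)
  finally show "H_mat B A \<bullet> X = (\<integral>\<theta>. (?s \<theta> - 1) * (\<theta> \<bullet> (X *v \<theta>)) \<partial>sphere_unif)" .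
qed

lemma inner_transpose: "transpose A \<bullet> X = A \<bullet> transpose (X :: real^'n^'m)"
  unfolding inner_vec_def transpose_def by (simp, rule sum.swap)

text \<open>By \<open>H_mat_inner\<close> a pairing with \<open>X\<close> depends only on the
  quadratic form of \<open>X\<close>, which transposition preserves.\<close>

lemma transpose_H_mat:
  assumes A: "sym_posdef A"
  shows "transpose (H_mat B A) = H_mat B A"
proof -
  have "\<theta> \<bullet> (transpose X *v \<theta>) = \<theta> \<bullet> (X *v \<theta>)" for X :: "real^'a^'a" and \<theta>
    by (metis dot_lmul_matrix inner_commute transpose_matrix_vector)
  then have "transpose (H_mat B A) \<bullet> X = H_mat B A \<bullet> X" for X
    unfolding inner_transpose by (simp add: H_mat_inner[OF A])
  then show ?thesis by (metis vector_eq_rdot)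
qed

text \<open>This is the subgradient inequality for \<open>- H_mat B A\<close>. At each \<theta> the
  integrand \<open>a + b - 2 * sqrt (a * b)\<close> is convex in \<open>a\<close>; with
  \<open>x\<close>, \<open>y\<close>, \<open>z\<close> the roots of the forms of \<open>A\<close>,
  \<open>A'\<close>, \<open>B\<close>, the slack is exactly
  \<open>z * (y - x)\<^sup>2 / x\<close>.\<close>

lemma sliced_gap_diff_ge:
  assumes A: "sym_posdef A" and A': "sym_posdef A'" and B: "sym_posdef B"
  shows "- (H_mat B A \<bullet> (A' - A)) \<le> sliced_gap A' B - sliced_gap A B"
proof -
  let ?q = "\<lambda>A \<theta>. \<theta> \<bullet> (A *v \<theta>)"
  have "0 \<le> (\<integral>\<theta>. (sqrt (?q A' \<theta>) - sqrt (?q B \<theta>))\<^sup>2 - (sqrt (?q A \<theta>) - sqrt (?q B \<theta>))\<^sup>2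
      + (sqrt (?q B \<theta> / ?q A \<theta>) - 1) * ?q (A' - A) \<theta> \<partial>sphere_unif)"
  proof (rule integral_nonneg_AE)
    show "AE \<theta> in sphere_unif. 0 \<le> (sqrt (?q A' \<theta>) - sqrt (?q B \<theta>))\<^sup>2
      - (sqrt (?q A \<theta>) - sqrt (?q B \<theta>))\<^sup>2 + (sqrt (?q B \<theta> / ?q A \<theta>) - 1) * ?q (A' - A) \<theta>"
      using AE_sphere_unif_norm
    proof eventually_elim
      case (elim \<theta>)
      define x y z where "x = sqrt (?q A \<theta>)" and "y = sqrt (?q A' \<theta>)" and "z = sqrt (?q B \<theta>)"
      have "0 < ?q A \<theta>" "0 < ?q A' \<theta>" "0 < ?q B \<theta>"
        using sym_posdef_quadratic_form_bounds(3)[OF _ elim] A A' B by auto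
      then have pos: "x > 0" "z > 0" and sq: "?q A \<theta> = x\<^sup>2" "?q A' \<theta> = y\<^sup>2"
        by (auto simp: x_def y_def z_def)
      have "0 \<le> z * (y - x)\<^sup>2 / x" using pos by simp
      also have "\<dots> = (y - z)\<^sup>2 - (x - z)\<^sup>2 + (z / x - 1) * (y\<^sup>2 - x\<^sup>2)"
        using pos by (simp add: field_simps power2_eq_square)
      also have "\<dots> = (sqrt (?q A' \<theta>) - sqrt (?q B \<theta>))\<^sup>2
        - (sqrt (?q A \<theta>) - sqrt (?q B \<theta>))\<^sup>2 + (sqrt (?q B \<theta> / ?q A \<theta>) - 1) * ?q (A' - A) \<theta>"
        unfolding real_sqrt_divide x_def[symmetric] y_def[symmetric] z_def[symmetric]
        by (simp only: matrix_vector_mult_diff_rdistrib inner_diff_right sq)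
      finally show ?case .
    qed
  qed
  also have "\<dots> = sliced_gap A' B - sliced_gap A B + H_mat B A \<bullet> (A' - A)"
    unfolding sliced_gap_def H_mat_inner[OF A]
    by (simp only: Bochner_Integration.integral_add Bochner_Integration.integral_diff
        Bochner_Integration.integrable_diff integrable_sliced_gap integrable_H_mat[OF A])
  finally show ?thesis by simp
qed

text \<open>
  Since \<open>trace A / n\<close> is the squared \<open>L\<^sup>2\<close> norm of the square root of the quadratic form of \<open>A\<close>,
  this is Minkowski's inequality.
\<close>

lemma sqrt_trace_le_sliced_gap:
  fixes A B :: "real^'n^'n"
  assumes A: "sym_posdef A" and B: "sym_posdef B"
  shows "sqrt (trace A / real CARD('n)) \<le> sqrt (trace B / real CARD('n)) + sqrt (sliced_gap A B)"
proof -
  let ?q = "\<lambda>A \<theta>. \<theta> \<bullet> (A *v \<theta>)" and ?I = "\<lambda>f. \<integral>\<theta>. f \<theta> \<partial>(sphere_unif :: (real^'n) measure)"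
  define p where "p = sqrt (trace A / real CARD('n))"
  define q where "q = sqrt (trace B / real CARD('n))"
  have "0 < trace A" "0 < trace B"
    using lambda_min_pos lambda_min_le_trace A B by (force intro: less_le_trans)+
  then have pos: "0 < p" "0 < q" and p2: "trace A / real CARD('n) = p\<^sup>2" and q2: "trace B / real CARD('n) = q\<^sup>2"
    by (auto simp: p_def q_def)
  define c where "c = ?I (\<lambda>\<theta>. sqrt (?q A \<theta>) * sqrt (?q B \<theta>))"
  have int: "integrable sphere_unif (\<lambda>\<theta>. sqrt (?q A \<theta>) * sqrt (?q B \<theta>))"
    by (rule integrable_sphere_unif_continuous) (measurable, intro continuous_intros)
  have nn: "0 \<le> ?q A \<theta>" "0 \<le> ?q B \<theta>" for \<theta>
    using A B by (cases "\<theta> = 0"; force simp: sym_posdef_def)+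
  \<comment> \<open>One expansion serves twice: the weights \<open>q\<close>, \<open>p\<close> give
    the Cauchy-Schwarz bound \<open>c \<le> p * q\<close>, the weights 1, 1 give the gap
    itself.\<close>
  have sq: "?I (\<lambda>\<theta>. (u * sqrt (?q A \<theta>) - v * sqrt (?q B \<theta>))\<^sup>2) = u\<^sup>2 * p\<^sup>2 + v\<^sup>2 * q\<^sup>2 - 2 * u * v * c" for u v
  proof -
    have "?I (\<lambda>\<theta>. (u * sqrt (?q A \<theta>) - v * sqrt (?q B \<theta>))\<^sup>2)
      = ?I (\<lambda>\<theta>. u\<^sup>2 * ?q A \<theta> + v\<^sup>2 * ?q B \<theta> - 2 * u * v * (sqrt (?q A \<theta>) * sqrt (?q B \<theta>)))"
      using nn by (intro Bochner_Integration.integral_cong refl) (simp add: power2_diff power_mult_distrib)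
    also have "\<dots> = u\<^sup>2 * p\<^sup>2 + v\<^sup>2 * q\<^sup>2 - 2 * u * v * c"
      by (simp add: integrable_quadratic_form int integral_sphere_unif_quadratic_form c_def flip: p2 q2)
    finally show ?thesis .
  qed
  have "0 \<le> ?I (\<lambda>\<theta>. (q * sqrt (?q A \<theta>) - p * sqrt (?q B \<theta>))\<^sup>2)"
    by (rule Bochner_Integration.integral_nonneg) simp
  then have "2 * (p * q) * c \<le> 2 * (p * q) * (p * q)"
    unfolding sq by (simp add: power2_eq_square mult_ac)
  then have "c \<le> p * q" using pos by simp
  then have "(p - q)\<^sup>2 \<le> sliced_gap A B"
    using sq[of 1 1] by (simp add: sliced_gap_def power2_diff)
  then have "p - q \<le> sqrt (sliced_gap A B)" by (rule real_le_rsqrt)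
  then show ?thesis by (simp add: p_def q_def)
qed

text \<open>
  Let \<open>a\<close> and \<open>b\<close> be the quadratic forms of \<open>A\<close> and \<open>B\<close> on the sphere. Then \<open>J = H \<bullet> (B - A)\<close> is the integral of
  \<open>(sqrt b - sqrt a)\<^sup>2 * (1 + sqrt (b / a))\<close>, so \<open>J\<close> is at least \<open>2 * k\<close> times the gap when \<open>k \<le> 1\<close>
  is a lower bound of \<open>sqrt (b / a)\<close>. The fourth moments of the sphere bound the square of
  \<open>norm (B - A)\<close> by the integral of \<open>(b - a)\<^sup>2\<close>, which is at most \<open>2 * \<beta> * J\<close>.
  Finally \<open>J\<close> is at most \<open>norm H * norm (B - A)\<close>.
\<close>

lemma norm_H_mat_ge_sliced_gap:
  fixes A B :: "real^'n^'n"
  assumes A: "sym_posdef A" and B: "sym_posdef B" and tA: "trace A \<le> \<beta>" and tB: "trace B \<le> \<beta>"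
  shows "2 * sqrt (lambda_min B / \<beta>) * sliced_gap A B
      \<le> real CARD('n) * (real CARD('n) + 2) * \<beta> * (norm (H_mat B A))\<^sup>2"
    and "(norm (B - A))\<^sup>2 \<le> 2 * \<beta> * (real CARD('n) * (real CARD('n) + 2)) * sliced_gap A B"
proof -
  let ?q = "\<lambda>A \<theta>. \<theta> \<bullet> (A *v \<theta>)" and ?I = "\<lambda>f. \<integral>\<theta>. f \<theta> \<partial>(sphere_unif :: (real^'n) measure)"
  define N where "N = real CARD('n) * (real CARD('n) + 2)"
  \<comment> \<open>On the sphere the form of \<open>B\<close> is at least
    \<open>lambda_min B\<close> and that of \<open>A\<close> at most
    \<open>trace A \<le> \<beta>\<close>. The bound \<open>k \<le> 1\<close> follows from
    \<open>lambda_min B \<le> trace B \<le> \<beta>\<close>.\<close>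
  define k where "k = sqrt (lambda_min B / \<beta>)"
  define J where "J = H_mat B A \<bullet> (B - A)"
  define F where "F = sliced_gap A B"
  have N: "N > 0" by (simp add: N_def)
  have lB: "0 < lambda_min B" "lambda_min B \<le> \<beta>"
    using lambda_min_pos[OF B] lambda_min_le_trace[OF B] tB by auto
  then have \<beta>: "0 < \<beta>" by simp
  have k: "0 < k" "k \<le> 1" using lB by (auto simp: k_def)
  have F: "0 \<le> F" by (simp add: F_def sliced_gap_nonneg)
  have *: "\<exists>x y. 0 < x \<and> 0 < y \<and> k * x \<le> y \<and> x\<^sup>2 \<le> \<beta> \<and> y\<^sup>2 \<le> \<beta> \<and> sqrt (?q A \<theta>) = x \<and> sqrt (?q B \<theta>) = y
      \<and> sqrt (?q B \<theta> / ?q A \<theta>) = y / x \<and> ?q (B - A) \<theta> = y\<^sup>2 - x\<^sup>2" if \<theta>: "norm \<theta> = 1" for \<theta>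
  proof -
    note a = sym_posdef_quadratic_form_bounds[OF A \<theta>] and b = sym_posdef_quadratic_form_bounds[OF B \<theta>]
    have "lambda_min B / \<beta> * ?q A \<theta> \<le> lambda_min B / \<beta> * \<beta>"
      using a tA lB by (intro mult_left_mono) auto
    also have "\<dots> \<le> ?q B \<theta>" using b \<beta> by simp
    finally have "k * sqrt (?q A \<theta>) \<le> sqrt (?q B \<theta>)"
      unfolding k_def by (simp flip: real_sqrt_mult)
    then show ?thesis
      using a b tA tB
      by (intro exI[of _ "sqrt (?q A \<theta>)"] exI[of _ "sqrt (?q B \<theta>)"])
         (auto simp: real_sqrt_divide matrix_vector_mult_diff_rdistrib inner_diff_right)
  qed
  have int2: "integrable sphere_unif (\<lambda>\<theta>. (?q (B - A) \<theta>)\<^sup>2)"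
    by (rule integrable_sphere_unif_continuous) (measurable, intro continuous_intros)
  have JI: "J = ?I (\<lambda>\<theta>. (sqrt (?q B \<theta> / ?q A \<theta>) - 1) * ?q (B - A) \<theta>)"
    by (simp add: J_def H_mat_inner[OF A])
  \<comment> \<open>The squared trace in the fourth moment formula is nonnegative and is
    discarded.\<close>
  have D2: "2 * (norm (B - A))\<^sup>2 / N \<le> ?I (\<lambda>\<theta>. (?q (B - A) \<theta>)\<^sup>2)"
  proof -
    have "transpose (B - A) = B - A"
      using A B by (simp add: sym_posdef_def transpose_def vec_eq_iff)
    then show ?thesis
      using N by (simp add: integral_sphere_unif_quadratic_form_squared N_def divide_right_mono)
  qed
  have "2 * k * F = ?I (\<lambda>\<theta>. 2 * k * (sqrt (?q A \<theta>) - sqrt (?q B \<theta>))\<^sup>2)"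
    by (simp add: F_def sliced_gap_def)
  also have "\<dots> \<le> J"
    unfolding JI
  proof (rule integral_sphere_unif_mono)
    fix \<theta> :: "real^'n" assume "norm \<theta> = 1"
    then obtain x y where xy: "0 < x" "0 < y" "k * x \<le> y" "sqrt (?q A \<theta>) = x" "sqrt (?q B \<theta>) = y"
      "sqrt (?q B \<theta> / ?q A \<theta>) = y / x" "?q (B - A) \<theta> = y\<^sup>2 - x\<^sup>2"
      using * by blast
    have "2 * k \<le> 1 + k" using k by simp
    also have "\<dots> \<le> 1 + y / x" using xy by (simp add: field_simps)
    finally have "2 * k * (x - y)\<^sup>2 \<le> (1 + y / x) * (x - y)\<^sup>2" by (rule mult_right_mono) simp
    also have "\<dots> = (y / x - 1) * (y\<^sup>2 - x\<^sup>2)" using xy by (simp add: field_simps power2_eq_square)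
    finally show "2 * k * (sqrt (?q A \<theta>) - sqrt (?q B \<theta>))\<^sup>2 \<le> (sqrt (?q B \<theta> / ?q A \<theta>) - 1) * ?q (B - A) \<theta>"
      by (simp only: xy)
  qed (auto intro: integrable_sliced_gap integrable_H_mat[OF A])
  finally have kFJ: "2 * k * F \<le> J" .
  have "?I (\<lambda>\<theta>. (?q (B - A) \<theta>)\<^sup>2) \<le> ?I (\<lambda>\<theta>. 2 * \<beta> * ((sqrt (?q B \<theta> / ?q A \<theta>) - 1) * ?q (B - A) \<theta>))"
  proof (rule integral_sphere_unif_mono)
    fix \<theta> :: "real^'n" assume "norm \<theta> = 1"
    then obtain x y where xy: "0 < x" "0 < y" "x\<^sup>2 \<le> \<beta>" "y\<^sup>2 \<le> \<beta>"
      "sqrt (?q B \<theta> / ?q A \<theta>) = y / x" "?q (B - A) \<theta> = y\<^sup>2 - x\<^sup>2"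
      using * by blast
    have "0 \<le> (x - y)\<^sup>2" by simp
    then have "x * (x + y) \<le> 2 * \<beta>" using xy(3,4) unfolding power2_eq_square by (simp add: algebra_simps)
    then have "x * (x + y) * ((y - x)\<^sup>2 * (x + y) / x) \<le> 2 * \<beta> * ((y - x)\<^sup>2 * (x + y) / x)"
      by (rule mult_right_mono) (use xy in auto)
    moreover have "(y\<^sup>2 - x\<^sup>2)\<^sup>2 = x * (x + y) * ((y - x)\<^sup>2 * (x + y) / x)"
      using xy by (simp add: field_simps power2_eq_square)
    moreover have "(y - x)\<^sup>2 * (x + y) / x = (y / x - 1) * (y\<^sup>2 - x\<^sup>2)"
      using xy by (simp add: field_simps power2_eq_square)
    ultimately show "(?q (B - A) \<theta>)\<^sup>2 \<le> 2 * \<beta> * ((sqrt (?q B \<theta> / ?q A \<theta>) - 1) * ?q (B - A) \<theta>)"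
      by (simp only: xy)
  qed (auto intro: int2 integrable_H_mat[OF A])
  also have "\<dots> = 2 * \<beta> * J" by (simp add: JI)
  finally have "2 * (norm (B - A))\<^sup>2 / N \<le> 2 * \<beta> * J"
    using D2 by simp
  then have "(norm (B - A))\<^sup>2 \<le> N * \<beta> * J"
    using N by (simp add: field_simps)
  moreover have "J \<le> norm (H_mat B A) * norm (B - A)"
    unfolding J_def by (rule norm_cauchy_schwarz)
  \<comment> \<open>Squaring the Cauchy-Schwarz bound and inserting the bound on
    \<open>norm (B - A)\<close> leaves \<open>J\<close> on both sides; one factor is
    cancelled.\<close>
  ultimately have "J \<le> (norm (H_mat B A))\<^sup>2 * (N * \<beta>)" if "0 < J"
  proof -
    assume D: "(norm (B - A))\<^sup>2 \<le> N * \<beta> * J" and le: "J \<le> norm (H_mat B A) * norm (B - A)"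
    have "J * J \<le> (norm (H_mat B A) * norm (B - A)) * (norm (H_mat B A) * norm (B - A))"
      using le that by (intro mult_mono) auto
    also have "\<dots> = (norm (H_mat B A))\<^sup>2 * (norm (B - A))\<^sup>2"
      by (simp add: power2_eq_square mult_ac)
    also have "\<dots> \<le> (norm (H_mat B A))\<^sup>2 * (N * \<beta> * J)"
      using D by (rule mult_left_mono) simp
    finally show ?thesis
      using that by (intro mult_right_le_imp_le[of J J]) (simp_all add: mult_ac)
  qed
  then have "J \<le> (norm (H_mat B A))\<^sup>2 * (N * \<beta>)"
    using N \<beta> by (cases "0 < J") (auto simp: not_less intro: order_trans)
  with kFJ show "2 * sqrt (lambda_min B / \<beta>) * sliced_gap A B
      \<le> real CARD('n) * (real CARD('n) + 2) * \<beta> * (norm (H_mat B A))\<^sup>2"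
    by (simp add: k_def F_def N_def mult_ac)
  \<comment> \<open>Here the gap is reached directly, without \<open>J\<close>, from
    \<open>(x + y)\<^sup>2 \<le> 4 * \<beta>\<close>. The resulting estimate later turns decay of
    the gap into convergence of the covariance.\<close>
  have "?I (\<lambda>\<theta>. (?q (B - A) \<theta>)\<^sup>2) \<le> ?I (\<lambda>\<theta>. 4 * \<beta> * (sqrt (?q A \<theta>) - sqrt (?q B \<theta>))\<^sup>2)"
  proof (rule integral_sphere_unif_mono)
    fix \<theta> :: "real^'n" assume "norm \<theta> = 1"
    then obtain x y where xy: "x\<^sup>2 \<le> \<beta>" "y\<^sup>2 \<le> \<beta>" "sqrt (?q A \<theta>) = x" "sqrt (?q B \<theta>) = y" "?q (B - A) \<theta> = y\<^sup>2 - x\<^sup>2"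
      using * by blast
    have "0 \<le> (x - y)\<^sup>2" by simp
    then have "(x + y)\<^sup>2 \<le> 4 * \<beta>" using xy(1,2) unfolding power2_eq_square by (simp add: algebra_simps)
    then have "(x + y)\<^sup>2 * (x - y)\<^sup>2 \<le> 4 * \<beta> * (x - y)\<^sup>2" by (rule mult_right_mono) simp
    moreover have "(x + y)\<^sup>2 * (x - y)\<^sup>2 = (y\<^sup>2 - x\<^sup>2)\<^sup>2" by algebra
    ultimately show "(?q (B - A) \<theta>)\<^sup>2 \<le> 4 * \<beta> * (sqrt (?q A \<theta>) - sqrt (?q B \<theta>))\<^sup>2"
      by (simp only: xy)
  qed (auto intro: int2 integrable_sliced_gap)
  also have "\<dots> = 4 * \<beta> * F" by (simp add: F_def sliced_gap_def)
  finally have "2 * (norm (B - A))\<^sup>2 / N \<le> 4 * \<beta> * F"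
    using D2 by simp
  then show "(norm (B - A))\<^sup>2 \<le> 2 * \<beta> * (real CARD('n) * (real CARD('n) + 2)) * sliced_gap A B"
    using N unfolding N_def[symmetric] F_def[symmetric] by (simp add: field_simps)
qed

text \<open>Symmetry of \<open>H\<close> and \<open>A\<close> gives both products the same pairing
  with \<open>H\<close>, and \<open>H \<bullet> (H ** A)\<close> is the sum of the quadratic form of
  \<open>A\<close> over the rows of \<open>H\<close>, to which coercivity applies row by
  row.\<close>

lemma H_mat_inner_flow_ge:
  fixes A B :: "real^'n^'n"
  assumes A: "sym_posdef A" and \<alpha>: "\<And>x. \<alpha> * (x \<bullet> x) \<le> x \<bullet> (A *v x)"
  shows "2 * \<alpha> * (norm (H_mat B A))\<^sup>2 \<le> H_mat B A \<bullet> (H_mat B A ** A + A ** H_mat B A)"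
proof -
  let ?H = "H_mat B A"
  have sym: "transpose A = A" using A by (simp add: sym_posdef_def)
  have "?H \<bullet> (A ** ?H) = transpose ?H \<bullet> (A ** ?H)" by (simp only: transpose_H_mat[OF A])
  also have "\<dots> = ?H \<bullet> transpose (A ** ?H)" by (rule inner_transpose)
  also have "\<dots> = ?H \<bullet> (?H ** A)"
    by (simp only: matrix_transpose_mul transpose_H_mat[OF A] sym)
  finally have 1: "?H \<bullet> (?H ** A + A ** ?H) = 2 * (?H \<bullet> (?H ** A))" by (simp add: inner_add_right)
  have row: "(?H ** A) $ i = A *v (?H $ i)" for i
  proof -
    have "(?H ** A) $ i = transpose A *v (?H $ i)"
      by (simp add: vec_eq_iff matrix_matrix_mult_def matrix_vector_mult_def transpose_def mult.commute)
    then show ?thesis by (simp add: sym)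
  qed
  have "\<alpha> * (norm ?H)\<^sup>2 = (\<Sum>i\<in>UNIV. \<alpha> * (?H $ i \<bullet> ?H $ i))"
    by (simp only: power2_norm_eq_inner inner_vec_def[of ?H] sum_distrib_left)
  also have "\<dots> \<le> (\<Sum>i\<in>UNIV. ?H $ i \<bullet> (A *v (?H $ i)))"
    by (rule sum_mono) (rule \<alpha>)
  also have "\<dots> = ?H \<bullet> (?H ** A)"
    by (simp only: inner_vec_def[of ?H] row)
  finally show ?thesis using 1 by simp
qed

text \<open>The common lower bound \<alpha> keeps the denominators away from 0, so the constant
  \<open>sqrt (trace B / \<alpha>)\<close> dominates the integrands on the sphere.\<close>

lemma tendsto_H_mat:
  fixes A B :: "real^'n^'n"
  assumes B: "sym_posdef B" and \<alpha>: "0 < \<alpha>" and A: "\<And>x. \<alpha> * (x \<bullet> x) \<le> x \<bullet> (A *v x)"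
    and X: "\<And>k x. \<alpha> * (x \<bullet> x) \<le> x \<bullet> (X k *v x)" and lim: "X \<longlonglongrightarrow> A"
  shows "(\<lambda>k. H_mat B (X k)) \<longlonglongrightarrow> H_mat B A"
  unfolding H_mat_def
proof (rule tendsto_diff[OF _ tendsto_const], rule integral_dominated_convergence)
  let ?q = "\<lambda>A \<theta>. \<theta> \<bullet> (A *v \<theta>)"
  let ?f = "\<lambda>A \<theta>. sqrt (?q B \<theta> / ?q A \<theta>) *\<^sub>R outer \<theta>"
  show "?f A \<in> borel_measurable sphere_unif" "?f (X k) \<in> borel_measurable sphere_unif" for k
    by measurable
  show "integrable sphere_unif (\<lambda>_::real^'n. sqrt (trace B / \<alpha>))"
    by (rule integrable_sphere_unif) auto
  show "AE \<theta> in sphere_unif. (\<lambda>k. ?f (X k) \<theta>) \<longlonglongrightarrow> ?f A \<theta>"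
    using AE_sphere_unif_norm
  proof eventually_elim
    case (elim \<theta>)
    then have "\<theta> \<bullet> \<theta> = 1" by (simp add: norm_eq_1)
    then have "?q A \<theta> \<noteq> 0" using A[of \<theta>] \<alpha> by auto
    moreover have "(\<lambda>k. outer \<theta> \<bullet> X k) \<longlonglongrightarrow> outer \<theta> \<bullet> A" by (intro tendsto_intros lim)
    then have "(\<lambda>k. ?q (X k) \<theta>) \<longlonglongrightarrow> ?q A \<theta>" by (simp add: inner_outer)
    ultimately show ?case
      by (intro tendsto_scaleR tendsto_real_sqrt tendsto_divide tendsto_const)
  qed
  show "AE \<theta> in sphere_unif. norm (?f (X k) \<theta>) \<le> sqrt (trace B / \<alpha>)" for k
    using AE_sphere_unif_norm
  proof eventually_elim
    case (elim \<theta>)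
    then have "\<theta> \<bullet> \<theta> = 1" by (simp add: norm_eq_1)
    then have "\<alpha> \<le> ?q (X k) \<theta>" using X[of \<theta> k] by simp
    moreover have "0 < ?q B \<theta>" "?q B \<theta> \<le> trace B"
      using sym_posdef_quadratic_form_bounds[OF B elim] by auto
    ultimately have "0 \<le> ?q B \<theta> / ?q (X k) \<theta>" "?q B \<theta> / ?q (X k) \<theta> \<le> trace B / \<alpha>"
      using \<alpha> by (auto intro!: frac_le)
    then show ?case using elim by (simp add: norm_outer)
  qed
qed

subsection \<open>Decay along the flow\<close>

text \<open>
  The function \<open>\<psi>\<close> is a selection of subgradients of a convex function, evaluated along the curve \<open>\<phi>\<close>. Its continuity
  replaces differentiation under the integral sign.
\<close>

lemma has_vector_derivative_convex_composition:
  fixes \<phi> \<psi> :: "real \<Rightarrow> 'a::real_inner" and g :: "real \<Rightarrow> real"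
  assumes t: "t \<in> S"
    and sub: "\<And>u v. u \<in> S \<Longrightarrow> v \<in> S \<Longrightarrow> \<psi> u \<bullet> (\<phi> v - \<phi> u) \<le> g v - g u"
    and \<phi>: "(\<phi> has_vector_derivative \<phi>') (at t within S)"
    and \<psi>: "(\<psi> \<longlongrightarrow> \<psi> t) (at t within S)"
  shows "(g has_vector_derivative \<psi> t \<bullet> \<phi>') (at t within S)"
proof -
  \<comment> \<open>Normalized remainders: \<open>\<rho>\<close> of the curve against its
    derivative, \<open>\<tau>\<close> of \<open>g\<close> against its subgradient at
    \<open>t\<close>. The claim is that \<open>\<tau> u + \<psi> t \<bullet> \<rho> u\<close> tends
    to 0.\<close>
  define \<rho> where "\<rho> u = (1 / norm (u - t)) *\<^sub>R (\<phi> u - (\<phi> t + (u - t) *\<^sub>R \<phi>'))" for u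
  define \<tau> where "\<tau> u = (1 / norm (u - t)) * (g u - g t - \<psi> t \<bullet> (\<phi> u - \<phi> t))" for u
  have \<rho>: "(\<rho> \<longlongrightarrow> 0) (at t within S)"
    using \<phi> by (simp add: has_vector_derivative_def has_derivative_within \<rho>_def[abs_def])
  have S: "\<forall>\<^sub>F u in at t within S. u \<in> S \<and> u \<noteq> t"
    by (simp add: eventually_at_filter)
  have "(\<tau> \<longlongrightarrow> 0) (at t within S)"
  proof (rule tendsto_sandwich)
    show "\<forall>\<^sub>F u in at t within S. 0 \<le> \<tau> u"
      using S by eventually_elim (use sub[OF t] in \<open>simp add: \<tau>_def\<close>)
    show "\<forall>\<^sub>F u in at t within S. \<tau> u \<le> norm (\<psi> u - \<psi> t) * (norm (\<rho> u) + norm \<phi>')"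
      using S
    proof eventually_elim
      case (elim u)
      \<comment> \<open>The upper bound uses the subgradient at \<open>u\<close> instead of
        \<open>t\<close>, so only the increment of \<open>\<psi>\<close> remains, multiplied by an
        increment of \<open>\<phi>\<close> of order \<open>norm (u - t)\<close>.\<close>
      have "g u - g t - \<psi> t \<bullet> (\<phi> u - \<phi> t) \<le> (\<psi> u - \<psi> t) \<bullet> (\<phi> u - \<phi> t)"
        using sub[of u t] elim t by (simp add: inner_diff_left inner_diff_right)
      also have "\<dots> \<le> norm (\<psi> u - \<psi> t) * norm (\<phi> u - \<phi> t)"
        by (rule norm_cauchy_schwarz)
      also have "\<dots> \<le> norm (\<psi> u - \<psi> t) * (norm (u - t) * (norm (\<rho> u) + norm \<phi>'))"
      proof (rule mult_left_mono)
        have "\<phi> u - \<phi> t = norm (u - t) *\<^sub>R \<rho> u + (u - t) *\<^sub>R \<phi>'"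
          using elim by (simp add: \<rho>_def)
        also have "norm \<dots> \<le> norm (u - t) * (norm (\<rho> u) + norm \<phi>')"
          by (rule norm_triangle_le) (simp add: distrib_left)
        finally show "norm (\<phi> u - \<phi> t) \<le> norm (u - t) * (norm (\<rho> u) + norm \<phi>')" .
      qed simp
      finally have "g u - g t - \<psi> t \<bullet> (\<phi> u - \<phi> t)
          \<le> norm (u - t) * (norm (\<psi> u - \<psi> t) * (norm (\<rho> u) + norm \<phi>'))"
        by (simp only: mult_ac)
      then show ?case
        using elim by (simp add: \<tau>_def field_simps)
    qed
    have "((\<lambda>u. \<psi> u - \<psi> t) \<longlongrightarrow> 0) (at t within S)"
      using \<psi> by (simp add: LIM_zero)
    then have "((\<lambda>u. norm (\<psi> u - \<psi> t) * (norm (\<rho> u) + norm \<phi>')) \<longlongrightarrow> norm (0::'a) * (norm (0::'a) + norm \<phi>')) (at t within S)"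
      by (intro tendsto_intros \<rho>)
    then show "((\<lambda>u. norm (\<psi> u - \<psi> t) * (norm (\<rho> u) + norm \<phi>')) \<longlongrightarrow> 0) (at t within S)"
      by simp
  qed simp
  then have "((\<lambda>u. \<tau> u + \<psi> t \<bullet> \<rho> u) \<longlongrightarrow> 0 + \<psi> t \<bullet> 0) (at t within S)"
    by (intro tendsto_intros \<rho>)
  moreover have "\<tau> u + \<psi> t \<bullet> \<rho> u = (1 / norm (u - t)) *\<^sub>R (g u - (g t + (u - t) *\<^sub>R (\<psi> t \<bullet> \<phi>')))" for u
    by (simp add: \<tau>_def \<rho>_def inner_simps algebra_simps)
  ultimately show ?thesis
    by (simp add: has_vector_derivative_def has_derivative_within bounded_linear_mult_left)
qed

text \<open>The integrating factor \<open>exp (c * L u)\<close> makes the product with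
  \<open>h\<close> nonincreasing. The sign of \<open>c\<close> is free; \<open>c = 0\<close> yields
  plain monotonicity.\<close>

lemma gronwall_nonpos:
  fixes h h' lam :: "real \<Rightarrow> real"
  assumes lam: "continuous_on {a..<b} lam"
    and h: "\<And>t. t \<in> {a..<b} \<Longrightarrow> (h has_vector_derivative h' t) (at t within {a..<b})"
    and le: "\<And>t. t \<in> {a..<b} \<Longrightarrow> h' t \<le> - c * lam t * h t"
    and t: "t \<in> {a..<b}"
  shows "h t \<le> h a * exp (- c * integral {a..t} lam)"
proof (cases "a < t")
  case True
  define L where "L u = integral {a..u} lam" for u
  define \<phi> where "\<phi> u = h u * exp (c * L u)" for u
  have sub: "{a..t} \<subseteq> {a..<b}" using t by auto
  have lam': "continuous_on {a..t} lam" using lam sub by (rule continuous_on_subset)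
  have contL: "continuous_on {a..t} L"
    unfolding L_def by (intro indefinite_integral_continuous_1 integrable_continuous_real lam')
  have "continuous_on {a..<b} h"
    unfolding continuous_on_eq_continuous_within using h has_vector_derivative_continuous by blast
  then have "continuous_on {a..t} h" using sub by (rule continuous_on_subset)
  then have "continuous_on {a..t} \<phi>"
    unfolding \<phi>_def by (intro continuous_intros contL)
  moreover have "\<exists>y. (\<phi> has_real_derivative y) (at x) \<and> y \<le> 0" if x: "a < x" "x < t" for x
  proof -
    have "at x within {a..<b} = at x"
      using x t by (intro at_within_interior) simp
    moreover have "(h has_vector_derivative h' x) (at x within {a..<b})"
      by (rule h) (use x t in auto)
    ultimately have "(h has_vector_derivative h' x) (at x)"
      by (simp only:)
    then have dh: "(h has_real_derivative h' x) (at x)"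
      by (rule has_real_derivative_iff_has_vector_derivative[THEN iffD2])
    have "(L has_vector_derivative lam x) (at x within {a..t})"
      unfolding L_def by (rule integral_has_vector_derivative) (use lam' x in auto)
    moreover have "at x within {a..t} = at x"
      using x by (intro at_within_interior) simp
    ultimately have dL: "(L has_real_derivative lam x) (at x)"
      by (simp only: has_real_derivative_iff_has_vector_derivative)
    have "(\<phi> has_real_derivative (h' x + c * lam x * h x) * exp (c * L x)) (at x)"
      unfolding \<phi>_def by (rule derivative_eq_intros dh dL refl)+ (simp add: algebra_simps)
    moreover have "(h' x + c * lam x * h x) * exp (c * L x) \<le> 0"
      using le[of x] x t by (intro mult_nonpos_nonneg) auto
    ultimately show ?thesis by blast
  qed
  ultimately have "\<phi> t \<le> \<phi> a"
    using True by (intro DERIV_nonpos_imp_decreasing_open[of a t \<phi>]) auto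
  then have "h t * exp (c * L t) * exp (- c * L t) \<le> h a * exp (- c * L t)"
    by (intro mult_right_mono) (simp_all add: \<phi>_def L_def)
  then show ?thesis
    by (simp add: L_def mult.assoc flip: exp_add)
qed (use t in auto)

text \<open>Divergence is assumed for an extended nonnegative Lebesgue integral over the half-open
  interval, whereas the rate involves \<open>integral\<close> over compact pieces. Monotone
  convergence connects the two: if the pieces stayed bounded, so would the whole.\<close>

lemma integral_at_top_at_left:
  fixes lam :: "real \<Rightarrow> real"
  assumes "a < b" and lam: "continuous_on {a..<b} lam" and nn: "\<And>t. t \<in> {a..<b} \<Longrightarrow> 0 \<le> lam t"
    and inf: "(\<integral>\<^sup>+ t\<in>{a..<b}. ennreal (lam t) \<partial>lborel) = \<infinity>"
  shows "filterlim (\<lambda>t. integral {a..t} lam) at_top (at_left b)"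
proof -
  have cont: "continuous_on {a..t} lam" if "t < b" for t
    using lam by (rule continuous_on_subset) (use that in auto)
  have ni: "(\<integral>\<^sup>+ x. ennreal (lam x) * indicator {a..t} x \<partial>lborel) = ennreal (integral {a..t} lam)" if t: "t < b" for t
  proof -
    have si: "set_integrable lborel {a..t} lam" by (rule borel_integrable_atLeastAtMost'[OF cont[OF t]])
    have "(\<integral>\<^sup>+ x. ennreal (lam x) * indicator {a..t} x \<partial>lborel) = (\<integral>\<^sup>+ x. ennreal (indicator {a..t} x *\<^sub>R lam x) \<partial>lborel)"
      by (intro nn_integral_cong) (simp split: split_indicator)
    also have "\<dots> = ennreal (LINT x:{a..t}|lborel. lam x)"
      unfolding set_lebesgue_integral_def
      by (rule nn_integral_eq_integral) (use si nn t in \<open>auto simp: set_integrable_def indicator_def\<close>)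
    finally show ?thesis by (simp add: set_borel_integral_eq_integral(2)[OF si])
  qed
  have mono: "integral {a..s} lam \<le> integral {a..t} lam" if "s \<le> t" "t < b" for s t
    by (rule integral_subset_le) (use that nn in \<open>auto intro!: integrable_continuous_real cont\<close>)
  have unb: "\<exists>t\<in>{a..<b}. K < integral {a..t} lam" for K
  proof (rule ccontr)
    assume "\<not> ?thesis"
    then have K: "integral {a..t} lam \<le> K" if "t \<in> {a..<b}" for t
      using that by force
    \<comment> \<open>With \<open>Suc n\<close> the sequence starts at \<open>a\<close>, stays below
      \<open>b\<close> and increases to \<open>b\<close>.\<close>
    define s where "s n = b - (b - a) / real (Suc n)" for n
    have s: "s n \<in> {a..<b}" for n
      using \<open>a < b\<close> mult_right_mono[of a b "real n"] by (auto simp: s_def field_simps)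
    have "incseq s"
      using \<open>a < b\<close> by (auto simp: incseq_def s_def intro!: divide_left_mono)
    have lim: "s \<longlonglongrightarrow> b"
      unfolding s_def using tendsto_diff[OF tendsto_const LIMSEQ_Suc[OF lim_const_over_n[of "b - a"]], of b]
      by simp
    define f where "f n x = ennreal (lam x) * indicator {a..s n} x" for n x
    have "incseq f"
      using \<open>incseq s\<close> unfolding f_def incseq_def le_fun_def
      by (auto split: split_indicator intro: order_trans)
    have sup: "(SUP n. f n x) = ennreal (lam x) * indicator {a..<b} x" for x
    proof (cases "x \<in> {a..<b}")
      case True
      then have "\<forall>\<^sub>F n in sequentially. x < s n" using lim by (auto intro: order_tendstoD)
      then obtain n where n: "x < s n" by (auto simp: eventually_sequentially)
      show ?thesis
      proof (rule antisym)
        show "(SUP n. f n x) \<le> ennreal (lam x) * indicator {a..<b} x"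
          using True by (intro SUP_least) (auto simp: f_def split: split_indicator)
        have "ennreal (lam x) * indicator {a..<b} x = f n x" using True n by (simp add: f_def)
        then show "ennreal (lam x) * indicator {a..<b} x \<le> (SUP n. f n x)"
          by (simp only:) (rule SUP_upper, simp)
      qed
    next
      case False
      then have "f n x = 0" for n using s[of n] by (auto simp: f_def split: split_indicator)
      then show ?thesis using False by simp
    qed
    have "f n \<in> borel_measurable lborel" for n
    proof -
      have "(\<lambda>x. indicator {a..s n} x *\<^sub>R lam x) \<in> borel_measurable lborel"
        using borel_integrable_atLeastAtMost'[OF cont[of "s n"]] s[of n] by (simp add: set_integrable_def)
      then have "(\<lambda>x. ennreal (indicator {a..s n} x *\<^sub>R lam x)) \<in> borel_measurable lborel" by measurable
      moreover have "f n = (\<lambda>x. ennreal (indicator {a..s n} x *\<^sub>R lam x))"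
        by (auto simp: f_def split: split_indicator)
      ultimately show ?thesis by simp
    qed
    then have "(\<integral>\<^sup>+ x. (SUP n. f n x) \<partial>lborel) = (SUP n. \<integral>\<^sup>+ x. f n x \<partial>lborel)"
      by (intro nn_integral_monotone_convergence_SUP \<open>incseq f\<close>)
    also have "\<dots> \<le> ennreal K"
      using s K ni by (intro SUP_least) (auto simp: f_def intro!: ennreal_leI)
    finally show False
      using inf unfolding sup by (simp add: top_unique)
  qed
  show ?thesis
    unfolding filterlim_at_top
  proof
    fix K
    obtain t where t: "t \<in> {a..<b}" "K < integral {a..t} lam" using unb by blast
    then have "\<forall>\<^sub>F u in at_left b. t < u \<and> u < b"
      unfolding eventually_at_left_field by (intro exI[of _ t]) auto
    then show "\<forall>\<^sub>F u in at_left b. K \<le> integral {a..u} lam"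
    proof eventually_elim
      case (elim u)
      then show ?case using mono[of t u] t by auto
    qed
  qed
qed

theorem theorem1:
  fixes m\<^sub>0 m\<^sub>1 :: "real^'n" and \<Sigma>\<^sub>0 \<Sigma>\<^sub>1 :: "real^'n^'n"
    and lam :: "real \<Rightarrow> real"
    and m :: "real \<Rightarrow> real^'n" and \<Sigma> :: "real \<Rightarrow> real^'n^'n"
    and \<rho> :: "real \<Rightarrow> (real^'n) measure" and \<rho>\<^sub>1 :: "(real^'n) measure"
    and r :: "real \<Rightarrow> real" and \<alpha> \<beta> chi :: real
  assumes "sym_posdef \<Sigma>\<^sub>0" and "sym_posdef \<Sigma>\<^sub>1"
    and "continuous_on {0..<1} lam" and "\<And>t. t \<in> {0..<1} \<Longrightarrow> 0 \<le> lam t"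
    and "gaussian_sliced_flow lam m\<^sub>0 \<Sigma>\<^sub>0 m\<^sub>1 \<Sigma>\<^sub>1 m \<Sigma>"
    and "\<And>t. t \<in> {0..<1} \<Longrightarrow> \<rho> t = gaussian (m t) (\<Sigma> t)"
    and "\<rho>\<^sub>1 = gaussian m\<^sub>1 \<Sigma>\<^sub>1"
    and "(\<integral>\<^sup>+ t\<in>{0..<1}. ennreal (lam t) \<partial>lborel) = \<infinity>"
    and "0 < \<alpha>" and "\<And>t. t \<in> {0..<1} \<Longrightarrow> loewner_le (\<alpha> *\<^sub>R mat 1) (\<Sigma> t)"
    and "\<And>t. t \<in> {0..<1} \<Longrightarrow> r t = SW2 (\<rho> t) \<rho>\<^sub>1"
    and "\<beta> = real CARD('n) * (sqrt (trace \<Sigma>\<^sub>1 / real CARD('n)) + r 0)\<^sup>2"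
    and "chi = min 1 (2 * \<alpha> * sqrt (lambda_min \<Sigma>\<^sub>1) / (\<beta> powr (3 / 2) * (real CARD('n) + 2)))"
  shows "(\<forall>t\<in>{0..<1}. r t \<le> r 0 * exp (- (chi / real CARD('n)) * integral {0..t} lam))
    \<and> (m \<longlongrightarrow> m\<^sub>1) (at_left 1) \<and> (\<Sigma> \<longlongrightarrow> \<Sigma>\<^sub>1) (at_left 1)"
proof -
  note B = assms(2) and lam = assms(3) and nn = assms(4) and \<alpha> = assms(9)
  let ?n = "real CARD('n)" and ?L = "\<lambda>t. integral {0..t} lam" and ?I = "{0..<1::real}"
  let ?H = "\<lambda>t. H_mat \<Sigma>\<^sub>1 (\<Sigma> t)"
  let ?D = "\<lambda>t. ?H t ** \<Sigma> t + \<Sigma> t ** ?H t"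
  define g where "g t = sliced_gap (\<Sigma> t) \<Sigma>\<^sub>1" for t
  \<comment> \<open>The contribution of the means to \<open>(r 0)\<^sup>2\<close>.\<close>
  define d where "d = (norm (m\<^sub>0 - m\<^sub>1))\<^sup>2 / ?n"
  have n: "0 < ?n" by simp
  have pd: "sym_posdef (\<Sigma> t)" if "t \<in> ?I" for t
    using assms(5) that by (auto simp: gaussian_sliced_flow_def)
  have deriv: "(\<Sigma> has_vector_derivative lam t *\<^sub>R ?D t) (at t within ?I)" if "t \<in> ?I" for t
    using assms(5) that by (auto simp: gaussian_sliced_flow_def)
  have mt: "m t - m\<^sub>1 = exp (- (1 / ?n) * ?L t) *\<^sub>R (m\<^sub>0 - m\<^sub>1)" if "t \<in> ?I" for t
    using assms(5) that by (auto simp: gaussian_sliced_flow_def)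
  have ge\<alpha>: "\<alpha> * (x \<bullet> x) \<le> x \<bullet> (\<Sigma> t *v x)" if "t \<in> ?I" for t x
    using assms(10)[OF that]
    by (simp add: loewner_le_def sym_possemidef_def matrix_vector_mult_diff_rdistrib inner_diff_right
        flip: scaleR_matrix_vector_assoc)
  have L0: "0 \<le> ?L t" if "t \<in> ?I" for t
    by (rule integral_nonneg)
       (use that nn in \<open>auto intro!: integrable_continuous_real continuous_on_subset[OF lam]\<close>)
  have g0: "0 \<le> g t" for t by (simp add: g_def sliced_gap_nonneg)
  have d0: "0 \<le> d" by (simp add: d_def)
  have r2: "(r t)\<^sup>2 = d * exp (- (2 / ?n) * ?L t) + g t" and r0: "0 \<le> r t" if t: "t \<in> ?I" for t
  proof -
    have "(norm (m t - m\<^sub>1))\<^sup>2 / ?n = d * exp (- (2 / ?n) * ?L t)"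
      by (simp add: mt[OF t] d_def power_mult_distrib exp_double[symmetric] flip: exp_of_nat_mult)
    then show "(r t)\<^sup>2 = d * exp (- (2 / ?n) * ?L t) + g t" "0 \<le> r t"
      using SW2_gaussian[OF pd[OF t] B, of "m t" m\<^sub>1] assms(6,11)[OF t] assms(7)
      by (auto simp: g_def)
  qed
  have r20: "(r 0)\<^sup>2 = d + g 0" using r2[of 0] by simp
  have dg: "(g has_vector_derivative - ?H t \<bullet> (lam t *\<^sub>R ?D t)) (at t within ?I)" if t: "t \<in> ?I" for t
  proof (rule has_vector_derivative_convex_composition[OF t _ deriv[OF t]])
    show "- ?H u \<bullet> (\<Sigma> v - \<Sigma> u) \<le> g v - g u" if "u \<in> ?I" "v \<in> ?I" for u v
      using sliced_gap_diff_ge[OF pd pd B] that by (simp add: g_def)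
    show "((\<lambda>t. - ?H t) \<longlongrightarrow> - ?H t) (at t within ?I)"
      unfolding tendsto_at_iff_sequentially comp_def
    proof (intro allI impI)
      fix X assume X: "\<forall>i. X i \<in> ?I - {t}" "X \<longlonglongrightarrow> t"
      have "continuous (at t within ?I) \<Sigma>"
        using deriv[OF t] by (rule has_vector_derivative_continuous)
      then have "(\<lambda>i. \<Sigma> (X i)) \<longlonglongrightarrow> \<Sigma> t"
        using X by (auto simp: continuous_within_sequentially comp_def)
      then show "(\<lambda>i. - ?H (X i)) \<longlonglongrightarrow> - ?H t"
        using X t by (intro tendsto_minus tendsto_H_mat[OF B \<alpha>]) (auto intro!: ge\<alpha>)
    qed
  qed
  have dg_le: "- ?H t \<bullet> (lam t *\<^sub>R ?D t) \<le> - (2 * \<alpha> * lam t * (norm (?H t))\<^sup>2)" if t: "t \<in> ?I" for t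
    using mult_left_mono[OF H_mat_inner_flow_ge[OF pd[OF t] ge\<alpha>[OF t], of \<Sigma>\<^sub>1] nn[OF t]]
    by (simp add: mult_ac)
  \<comment> \<open>Monotonicity, as Gronwall with rate 0, has to precede the decay estimate,
    because the latter relies on the trace bound that monotonicity provides.\<close>
  have g_le: "g t \<le> g 0" if t: "t \<in> ?I" for t
  proof -
    have "g t \<le> g 0 * exp (- 0 * ?L t)"
    proof (rule gronwall_nonpos[OF lam dg _ t])
      fix s assume s: "s \<in> ?I"
      have "0 \<le> 2 * \<alpha> * lam s * (norm (?H s))\<^sup>2" using \<alpha> nn[OF s] by simp
      then show "- ?H s \<bullet> (lam s *\<^sub>R ?D s) \<le> - 0 * lam s * g s"
        using dg_le[OF s] by simp
    qed
    then show ?thesis by simp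
  qed
  have trB: "0 < trace \<Sigma>\<^sub>1" using lambda_min_pos[OF B] lambda_min_le_trace[OF B] by simp
  \<comment> \<open>Origin of \<open>\<beta>\<close>: Minkowski's inequality together with
    \<open>sqrt (g t) \<le> r 0\<close>, squared and multiplied by \<open>n\<close>.\<close>
  have trace_le: "trace (\<Sigma> t) \<le> \<beta>" if t: "t \<in> ?I" for t
  proof -
    have "g t \<le> (r 0)\<^sup>2" using g_le[OF t] r20 d0 by simp
    then have "sqrt (g t) \<le> r 0" using r0[of 0] by (simp add: real_le_lsqrt)
    then have "sqrt (trace (\<Sigma> t) / ?n) \<le> sqrt (trace \<Sigma>\<^sub>1 / ?n) + r 0"
      using sqrt_trace_le_sliced_gap[OF pd[OF t] B] by (simp add: g_def)
    then have "trace (\<Sigma> t) / ?n \<le> (sqrt (trace \<Sigma>\<^sub>1 / ?n) + r 0)\<^sup>2"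
      by (rule sqrt_le_D)
    then show ?thesis using n by (simp add: assms(12) field_simps)
  qed
  have trB_le: "trace \<Sigma>\<^sub>1 \<le> \<beta>"
  proof -
    have "(sqrt (trace \<Sigma>\<^sub>1 / ?n))\<^sup>2 \<le> (sqrt (trace \<Sigma>\<^sub>1 / ?n) + r 0)\<^sup>2"
      using r0[of 0] trB by (intro power_mono) auto
    then show ?thesis using n trB by (simp add: assms(12) field_simps)
  qed
  then have \<beta>: "0 < \<beta>" using trB by simp
  have lmin: "0 < lambda_min \<Sigma>\<^sub>1" by (rule lambda_min_pos[OF B])
  have chi: "0 < chi" "chi \<le> 1" using \<alpha> lmin \<beta> n by (auto simp: assms(13))
  have chi_le: "chi \<le> 2 * \<alpha> * sqrt (lambda_min \<Sigma>\<^sub>1 / \<beta>) / (\<beta> * (?n + 2))"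
  proof -
    have "\<beta> powr (3 / 2) = \<beta> powr (1 + 1 / 2)" by simp
    also have "\<dots> = \<beta> * sqrt \<beta>" using \<beta> by (simp only: powr_add powr_half_sqrt) simp
    finally have "\<beta> powr (3 / 2) = \<beta> * sqrt \<beta>" .
    then have "2 * \<alpha> * sqrt (lambda_min \<Sigma>\<^sub>1) / (\<beta> powr (3 / 2) * (?n + 2))
        = 2 * \<alpha> * sqrt (lambda_min \<Sigma>\<^sub>1 / \<beta>) / (\<beta> * (?n + 2))"
      by (simp add: real_sqrt_divide mult_ac)
    then show ?thesis by (simp add: assms(13))
  qed
  \<comment> \<open>The exponent is \<open>2 * chi / n\<close>, twice that of the theorem, because
    \<open>g\<close> lives on the scale of the squared distance.\<close>
  have g_decay: "g t \<le> g 0 * exp (- (2 * chi / ?n) * ?L t)" if t: "t \<in> ?I" for t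
  proof (rule gronwall_nonpos[OF lam dg _ t])
    fix s assume s: "s \<in> ?I"
    have "chi * (\<beta> * (?n + 2)) \<le> 2 * \<alpha> * sqrt (lambda_min \<Sigma>\<^sub>1 / \<beta>)"
      using chi_le pos_le_divide_eq[of "\<beta> * (?n + 2)"] \<beta> by (simp add: add_nonneg_pos)
    then have "chi * (\<beta> * (?n + 2)) * g s \<le> 2 * \<alpha> * sqrt (lambda_min \<Sigma>\<^sub>1 / \<beta>) * g s"
      by (rule mult_right_mono) (rule g0)
    also have "\<dots> = \<alpha> * (2 * sqrt (lambda_min \<Sigma>\<^sub>1 / \<beta>) * g s)" by simp
    also have "\<dots> \<le> \<alpha> * (?n * (?n + 2) * \<beta> * (norm (?H s))\<^sup>2)"
      unfolding g_def
      by (rule mult_left_mono[OF norm_H_mat_ge_sliced_gap(1)[OF pd[OF s] B trace_le[OF s] trB_le]])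
         (use \<alpha> in simp)
    finally have "(\<beta> * (?n + 2)) * (chi * g s) \<le> (\<beta> * (?n + 2)) * (?n * \<alpha> * (norm (?H s))\<^sup>2)"
      by (simp add: mult_ac)
    moreover have "0 < \<beta> * (?n + 2)" using \<beta> by (simp add: add_nonneg_pos)
    ultimately have "chi * g s \<le> ?n * \<alpha> * (norm (?H s))\<^sup>2" by (simp only: mult_le_cancel_left_pos)
    then have "2 * chi / ?n * g s \<le> 2 * \<alpha> * (norm (?H s))\<^sup>2" using n by (simp add: field_simps)
    from mult_left_mono[OF this nn[OF s]]
    show "- ?H s \<bullet> (lam s *\<^sub>R ?D s) \<le> - (2 * chi / ?n) * lam s * g s"
      using dg_le[OF s] by (simp add: mult_ac)
  qed
  \<comment> \<open>In the squared distance the mean decays with exponent \<open>2 / n\<close> and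
    the gap with \<open>2 * chi / n\<close>. As \<open>chi \<le> 1\<close>, the second is a common
    rate for both.\<close>
  have decay: "r t \<le> r 0 * exp (- (chi / ?n) * ?L t)" if t: "t \<in> ?I" for t
  proof (rule power2_le_imp_le)
    have "- (2 / ?n) * ?L t \<le> - (2 * chi / ?n) * ?L t"
      using mult_right_mono[OF chi(2), of "2 / ?n * ?L t"] L0[OF t] n by (simp add: mult_ac)
    then have "d * exp (- (2 / ?n) * ?L t) \<le> d * exp (- (2 * chi / ?n) * ?L t)"
      using d0 by (intro mult_left_mono) auto
    then have "(r t)\<^sup>2 \<le> (d + g 0) * exp (- (2 * chi / ?n) * ?L t)"
      using g_decay[OF t] by (simp add: r2[OF t] distrib_right)
    also have "\<dots> = (r 0 * exp (- (chi / ?n) * ?L t))\<^sup>2"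
      by (simp add: r20 power_mult_distrib flip: exp_double)
    finally show "(r t)\<^sup>2 \<le> (r 0 * exp (- (chi / ?n) * ?L t))\<^sup>2" .
    show "0 \<le> r 0 * exp (- (chi / ?n) * ?L t)" using r0[of 0] by simp
  qed
  have Linf: "filterlim ?L at_top (at_left 1)"
    by (rule integral_at_top_at_left) (use lam nn assms(8) in auto)
  have exp0: "((\<lambda>t. exp (- c * ?L t)) \<longlongrightarrow> 0) (at_left 1)" if c: "0 < c" for c
  proof -
    have "filterlim (\<lambda>t. c * ?L t) at_top (at_left 1)"
      by (rule filterlim_tendsto_pos_mult_at_top[OF tendsto_const c Linf])
    then have "filterlim (\<lambda>t. - (c * ?L t)) at_bot (at_left 1)"
      by (simp add: filterlim_uminus_at_top)
    from filterlim_compose[OF exp_at_bot this] show ?thesis by simp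
  qed
  have I: "\<forall>\<^sub>F t in at_left 1. t \<in> ?I"
    unfolding eventually_at_left_field by (intro exI[of _ 0]) auto
  have "((\<lambda>t. m t - m\<^sub>1) \<longlongrightarrow> 0) (at_left 1)"
  proof (rule Lim_transform_eventually)
    show "((\<lambda>t. exp (- (1 / ?n) * ?L t) *\<^sub>R (m\<^sub>0 - m\<^sub>1)) \<longlongrightarrow> 0) (at_left 1)"
      using tendsto_scaleR[OF exp0[of "1 / ?n"] tendsto_const[of "m\<^sub>0 - m\<^sub>1"]] n by simp
    show "\<forall>\<^sub>F t in at_left 1. exp (- (1 / ?n) * ?L t) *\<^sub>R (m\<^sub>0 - m\<^sub>1) = m t - m\<^sub>1"
      using I by eventually_elim (simp only: mt)
  qed
  then have m1: "(m \<longlongrightarrow> m\<^sub>1) (at_left 1)" by (rule LIM_zero_cancel)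
  \<comment> \<open>Under the trace bound the gap controls the distance of the covariances, so its
    exponential decay is enough.\<close>
  have "((\<lambda>t. (norm (\<Sigma>\<^sub>1 - \<Sigma> t))\<^sup>2) \<longlongrightarrow> 0) (at_left 1)"
  proof (rule tendsto_sandwich[where f="\<lambda>_. 0"])
    let ?C = "2 * \<beta> * (?n * (?n + 2))"
    show "\<forall>\<^sub>F t in at_left 1. (norm (\<Sigma>\<^sub>1 - \<Sigma> t))\<^sup>2 \<le> ?C * (g 0 * exp (- (2 * chi / ?n) * ?L t))"
      using I
    proof eventually_elim
      case (elim t)
      have "(norm (\<Sigma>\<^sub>1 - \<Sigma> t))\<^sup>2 \<le> ?C * g t"
        using norm_H_mat_ge_sliced_gap(2)[OF pd[OF elim] B trace_le[OF elim] trB_le] by (simp only: g_def)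
      also have "\<dots> \<le> ?C * (g 0 * exp (- (2 * chi / ?n) * ?L t))"
        by (rule mult_left_mono[OF g_decay[OF elim]]) (use \<beta> in simp)
      finally show ?case .
    qed
    show "((\<lambda>t. ?C * (g 0 * exp (- (2 * chi / ?n) * ?L t))) \<longlongrightarrow> 0) (at_left 1)"
      using tendsto_mult_left[OF tendsto_mult_left[OF exp0[of "2 * chi / ?n"]], of ?C "g 0"] chi n by simp
  qed auto
  then have "((\<lambda>t. sqrt ((norm (\<Sigma>\<^sub>1 - \<Sigma> t))\<^sup>2)) \<longlongrightarrow> sqrt 0) (at_left 1)" by (rule tendsto_real_sqrt)
  then have "((\<lambda>t. \<Sigma> t - \<Sigma>\<^sub>1) \<longlongrightarrow> 0) (at_left 1)"
    by (intro tendsto_norm_zero_cancel[of "\<lambda>t. \<Sigma> t - \<Sigma>\<^sub>1"]) (simp add: norm_minus_commute)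
  then have S1: "(\<Sigma> \<longlongrightarrow> \<Sigma>\<^sub>1) (at_left 1)" by (rule LIM_zero_cancel)
  show ?thesis using decay m1 S1 by blast
qed

end
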